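(* For every constant $c>1$ there exists a constant $\delta=\delta(c)>0$ such that asymptotically almost surely $$\delta\sqrt{n}\;\le\;\mathrm{ccl}(G_{n,c/n})\;\le\;2\sqrt{cn}.$$
   Context: $G_{n,p}$ denotes the binomial random graph on $n$ vertices in which each pair of vertices is an edge independently with probability $p$; here $p=c/n$. A graph $H$ is a minor of $G$ if for every vertex $h$ of $H$ there is a set $B_h\subseteq V(G)$ inducing a connected subgraph of $G$, the sets $B_h$ are pairwise disjoint, and $G$ has an edge between $B_h$ and $B_{h'}$ whenever $hh'$ is an edge of $H$. $\mathrm{ccl}(G)$ denotes the largest $k$ such that the complete graph $K_k$ is a minor of $G$. An event holds asymptotically almost surely (a.a.s.) if its probability tends to $1$ as $n\to\infty$. *)

theory Defs
  imports "HOL-Analysis.Analysis"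
begin

text \<open>Simple graphs on the vertex set {0..<n}, represented by their edge sets:
  an edge is a 2-element subset of {0..<n}.\<close>

definition vertex_pairs :: "nat \<Rightarrow> nat set set" where
  "vertex_pairs n = {e. e \<subseteq> {..<n} \<and> card e = 2}"

text \<open>Probability that the binomial random graph G(n,p) satisfies property P:
  each of the (n choose 2) possible edges is present independently with probability p.\<close>

definition gnp_prob :: "nat \<Rightarrow> real \<Rightarrow> (nat set set \<Rightarrow> bool) \<Rightarrow> real" where
  "gnp_prob n p P =
     (\<Sum>E\<in>{E. E \<subseteq> vertex_pairs n \<and> P E}.
        p ^ card E * (1 - p) ^ (card (vertex_pairs n) - card E))"

text \<open>B induces a connected subgraph of the graph with edge set E (B nonempty).\<close>

definition connected_in :: "nat set set \<Rightarrow> nat set \<Rightarrow> bool" where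
  "connected_in E B \<longleftrightarrow> B \<noteq> {} \<and>
     (\<forall>u\<in>B. \<forall>v\<in>B. (u, v) \<in> {(x, y). x \<in> B \<and> y \<in> B \<and> {x, y} \<in> E}\<^sup>*)"

text \<open>K_k is a minor of the graph ({0..<n}, E): branch sets B 0, ..., B (k-1).\<close>

definition has_complete_minor :: "nat \<Rightarrow> nat set set \<Rightarrow> nat \<Rightarrow> bool" where
  "has_complete_minor n E k \<longleftrightarrow>
     (\<exists>B :: nat \<Rightarrow> nat set.
        (\<forall>i<k. B i \<subseteq> {..<n} \<and> connected_in E (B i)) \<and>
        (\<forall>i<k. \<forall>j<k. i \<noteq> j \<longrightarrow> B i \<inter> B j = {}) \<and>
        (\<forall>i<k. \<forall>j<k. i \<noteq> j \<longrightarrow> (\<exists>x\<in>B i. \<exists>y\<in>B j. {x, y} \<in> E)))"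

text \<open>Hadwiger number ccl: the largest k such that K_k is a minor.\<close>

definition ccl :: "nat \<Rightarrow> nat set set \<Rightarrow> nat" where
  "ccl n E = Max {k. has_complete_minor n E k}"

end

theory Submission
  imports Defs
begin

text \<open>Lower bound: split \<open>p = c / n\<close> as \<open>1 - (1 - p\<^sub>1) * (1 - p\<^sub>2)\<close> with \<open>p\<^sub>1 = c\<^sub>1 / n\<close>, \<open>1 < c\<^sub>1 < c\<close>.
  The first graph has a path of linear length: if at the moment when depth-first search has visited
  a small linear number of vertices its stack is still short, then a forest is present and almost all
  edges leaving it are absent, and the union bound over all such configurations is exponentially small
  because \<open>c\<^sub>1 * exp (1 - c\<^sub>1) < 1\<close>.

  Cut the path into \<open>k = 2 ^ R\<close> segments of length about \<open>sqrt n\<close>, where \<open>k\<close> is a small multiple of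
  \<open>sqrt n\<close>, and a reservoir of connectors, and expose the second graph. A connector that
  touches two segments can be used to join them. While more than \<open>4 ^ (s - 1)\<close> of the at most \<open>4 ^ s\<close> remaining
  pairs of segments are not joined, connectors of length about \<open>sqrt n / 2 ^ s\<close> suffice: by Chebyshev's
  inequality such a connector joins some remaining pair with probability at least \<open>15 / 16\<close>,
  provided that no segment lies in more than \<open>8 * 2 ^ s\<close> remaining pairs, which is achieved by discarding few
  segments. A union bound over all possible sets of remaining pairs makes this simultaneous, and
  the total length of all connectors is of order \<open>k * sqrt n\<close>, hence at most a small multiple of \<open>n\<close>.

  Upper bound: a graph with a \<open>K\<^sub>k\<close> minor has at least \<open>k choose 2\<close> edges, and the random graph has
  at most \<open>c * n\<close> edges with high probability.\<close>

section \<open>Random subsets of a finite set\<close>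

text \<open>The ground set is arbitrary because the measure is used in two roles: for the random
  edges, and for the random set of segments touched by a connector. Real-valued functions are
  allowed so that one part of the ground set can be exposed before another and so that second
  moments make sense.\<close>

definition rs_expect :: "'a set \<Rightarrow> real \<Rightarrow> ('a set \<Rightarrow> real) \<Rightarrow> real" where
  "rs_expect V p g = (\<Sum>E\<in>Pow V. p ^ card E * (1 - p) ^ (card V - card E) * g E)"

abbreviation rs_prob :: "'a set \<Rightarrow> real \<Rightarrow> ('a set \<Rightarrow> bool) \<Rightarrow> real" where
  "rs_prob V p P \<equiv> rs_expect V p (\<lambda>E. of_bool (P E))"

lemma rs_expect_empty [simp]: "rs_expect {} p g = g {}"
  by (simp add: rs_expect_def)

text \<open>Conditions on whether \<open>x\<close> is chosen. This recursion replaces the explicit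
  weights in the inductions over the ground set.\<close>

lemma rs_expect_insert:
  assumes "finite V" "x \<notin> V"
  shows "rs_expect (insert x V) p g
    = (1 - p) * rs_expect V p g + p * rs_expect V p (\<lambda>E. g (insert x E))"
proof -
  let ?w = "\<lambda>E. p ^ card E * (1 - p) ^ (card (insert x V) - card E) * g E"
  have disj: "Pow V \<inter> insert x ` Pow V = {}"
    using assms by auto
  have inj: "inj_on (insert x) (Pow V)"
    using assms by (auto simp: inj_on_def)
  have fin: "E \<subseteq> V \<Longrightarrow> finite E \<and> card E \<le> card V \<and> x \<notin> E" for E
    using assms finite_subset card_mono by blast
  have "rs_expect (insert x V) p g = sum ?w (Pow V) + sum ?w (insert x ` Pow V)"
    unfolding rs_expect_def Pow_insert using assms disj by (subst sum.union_disjoint) auto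
  also have "sum ?w (Pow V) = (1 - p) * rs_expect V p g"
    unfolding rs_expect_def sum_distrib_left using fin assms
    by (intro sum.cong) (auto simp: Suc_diff_le)
  also have "sum ?w (insert x ` Pow V) = p * rs_expect V p (\<lambda>E. g (insert x E))"
    unfolding rs_expect_def sum_distrib_left sum.reindex[OF inj] using fin assms
    by (intro sum.cong) auto
  finally show ?thesis .
qed

lemma rs_expect_cong:
  "(\<And>E. E \<subseteq> V \<Longrightarrow> g E = h E) \<Longrightarrow> rs_expect V p g = rs_expect V p h"
  by (simp add: rs_expect_def)

lemma rs_expect_mono:
  assumes "0 \<le> p" "p \<le> 1" "\<And>E. E \<subseteq> V \<Longrightarrow> g E \<le> h E"
  shows "rs_expect V p g \<le> rs_expect V p h"
  unfolding rs_expect_def using assms by (intro sum_mono mult_left_mono) auto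

lemma rs_expect_add: "rs_expect V p (\<lambda>E. g E + h E) = rs_expect V p g + rs_expect V p h"
  by (simp add: rs_expect_def distrib_left sum.distrib)

lemma rs_expect_diff: "rs_expect V p (\<lambda>E. g E - h E) = rs_expect V p g - rs_expect V p h"
  by (simp add: rs_expect_def right_diff_distrib sum_subtractf)

lemma rs_expect_cmult: "rs_expect V p (\<lambda>E. a * g E) = a * rs_expect V p g"
  by (simp add: rs_expect_def sum_distrib_left mult_ac)

lemma rs_expect_sum: "rs_expect V p (\<lambda>E. \<Sum>i\<in>I. g i E) = (\<Sum>i\<in>I. rs_expect V p (g i))"
  unfolding rs_expect_def sum_distrib_left by (rule sum.swap)

lemma rs_expect_const:
  assumes "finite V"
  shows "rs_expect V p (\<lambda>_. a) = a"
  using assms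
  by induction (simp_all add: rs_expect_insert algebra_simps)

lemma rs_expect_nonneg:
  assumes "0 \<le> p" "p \<le> 1" "\<And>E. E \<subseteq> V \<Longrightarrow> 0 \<le> g E"
  shows "0 \<le> rs_expect V p g"
  unfolding rs_expect_def using assms by (intro sum_nonneg mult_nonneg_nonneg) auto

lemma rs_prob_not:
  assumes "finite V"
  shows "rs_prob V p (\<lambda>E. \<not> P E) = 1 - rs_prob V p P"
  using rs_expect_diff[of V p "\<lambda>_. 1" "\<lambda>E. of_bool (P E)"]
  by (simp add: rs_expect_const[OF assms] of_bool_not_iff)

text \<open>Independence of the choices in disjoint parts of the ground set, in the form of Fubini's
  theorem.\<close>

lemma rs_expect_Un:
  assumes "finite A" "finite B" "A \<inter> B = {}"
  shows "rs_expect (A \<union> B) p g = rs_expect A p (\<lambda>X. rs_expect B p (\<lambda>Y. g (X \<union> Y)))"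
  using assms
proof (induction A arbitrary: g rule: finite_induct)
  case (insert x A)
  then show ?case by (simp add: rs_expect_insert)
qed simp

lemma rs_expect_restrict:
  assumes "finite V" "A \<subseteq> V"
  shows "rs_expect V p (\<lambda>E. g (E \<inter> A)) = rs_expect A p g"
proof -
  have "rs_expect (A \<union> (V - A)) p (\<lambda>E. g (E \<inter> A))
      = rs_expect A p (\<lambda>X. rs_expect (V - A) p (\<lambda>Y. g ((X \<union> Y) \<inter> A)))"
    using assms by (intro rs_expect_Un) (auto intro: finite_subset)
  also have "\<dots> = rs_expect A p (\<lambda>X. rs_expect (V - A) p (\<lambda>Y. g X))"
    by (intro rs_expect_cong arg_cong[of _ _ g]) auto
  also have "\<dots> = rs_expect A p g"
    using assms by (simp add: rs_expect_const)
  finally show ?thesis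
    using assms by (simp add: Un_absorb1)
qed

text \<open>Two-round exposure: an element is missed by both independent rounds with probability
  \<open>(1 - p) * (1 - q)\<close>.\<close>

lemma rs_expect_sprinkle:
  assumes "finite V"
  shows "rs_expect V p (\<lambda>X. rs_expect V q (\<lambda>Y. g (X \<union> Y))) = rs_expect V (1 - (1 - p) * (1 - q)) g"
  using assms
proof (induction V arbitrary: g rule: finite_induct)
  case (insert x V)
  note IH = insert.IH[of g] insert.IH[of "\<lambda>E. g (insert x E)"]
  show ?case
    using insert.hyps
    by (simp add: rs_expect_insert rs_expect_add rs_expect_cmult IH) (simp add: algebra_simps)
qed simp

text \<open>In the recursion an element of \<open>A\<close> kills the branch where it is absent and
  an element of \<open>B\<close> the branch where it is present; for any other element the two
  branches agree and their weights add up to 1.\<close>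

lemma rs_prob_contains_avoids:
  assumes "finite V" "A \<subseteq> V" "B \<subseteq> V" "A \<inter> B = {}"
  shows "rs_prob V p (\<lambda>E. A \<subseteq> E \<and> E \<inter> B = {}) = p ^ card A * (1 - p) ^ card B"
  using assms
proof (induction V arbitrary: A B rule: finite_induct)
  case (insert x V)
  note [simp] = rs_expect_insert[OF insert.hyps]
  have fin: "finite A" "finite B"
    using insert.prems insert.hyps by (auto intro: finite_subset)
  consider "x \<in> A" | "x \<in> B" | "x \<notin> A" "x \<notin> B" by blast
  then show ?case
  proof cases
    case 1
    have "rs_prob V p (\<lambda>E. A \<subseteq> E \<and> E \<inter> B = {}) = rs_expect V p (\<lambda>_. 0)"
      using 1 insert.hyps by (intro rs_expect_cong) auto
    moreover have "rs_prob V p (\<lambda>E. A \<subseteq> insert x E \<and> insert x E \<inter> B = {})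
        = rs_prob V p (\<lambda>E. (A - {x}) \<subseteq> E \<and> E \<inter> B = {})"
      using 1 insert.prems by (intro rs_expect_cong arg_cong[of _ _ of_bool]) auto
    moreover have "\<dots> = p ^ card (A - {x}) * (1 - p) ^ card B"
      using insert.prems 1 by (intro insert.IH) auto
    moreover have "card A = Suc (card (A - {x}))"
      using 1 fin card_Suc_Diff1 by metis
    ultimately show ?thesis
      using insert.hyps by (simp add: rs_expect_const)
  next
    case 2
    have "rs_prob V p (\<lambda>E. A \<subseteq> insert x E \<and> insert x E \<inter> B = {}) = rs_expect V p (\<lambda>_. 0)"
      using 2 insert.hyps by (intro rs_expect_cong) auto
    moreover have "rs_prob V p (\<lambda>E. A \<subseteq> E \<and> E \<inter> B = {})
        = rs_prob V p (\<lambda>E. A \<subseteq> E \<and> E \<inter> (B - {x}) = {})"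
      using 2 insert.hyps by (intro rs_expect_cong arg_cong[of _ _ of_bool]) auto
    moreover have "\<dots> = p ^ card A * (1 - p) ^ card (B - {x})"
      using insert.prems 2 by (intro insert.IH) auto
    moreover have "card B = Suc (card (B - {x}))"
      using 2 fin card_Suc_Diff1 by metis
    ultimately show ?thesis
      using insert.hyps by (simp add: rs_expect_const)
  next
    case 3
    have "rs_prob V p (\<lambda>E. A \<subseteq> insert x E \<and> insert x E \<inter> B = {})
        = rs_prob V p (\<lambda>E. A \<subseteq> E \<and> E \<inter> B = {})"
      using 3 insert.hyps by (intro rs_expect_cong arg_cong[of _ _ of_bool]) auto
    moreover have "rs_prob V p (\<lambda>E. A \<subseteq> E \<and> E \<inter> B = {}) = p ^ card A * (1 - p) ^ card B"
      using insert.prems 3 by (intro insert.IH) auto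
    ultimately show ?thesis by (simp add: algebra_simps)
  qed
qed simp

lemma rs_prob_contains:
  assumes "finite V" "A \<subseteq> V"
  shows "rs_prob V p (\<lambda>E. A \<subseteq> E) = p ^ card A"
  using rs_prob_contains_avoids[of V A "{}" p] assms by simp

lemma rs_expect_power_card:
  assumes "finite V"
  shows "rs_expect V p (\<lambda>E. t ^ card E) = (1 - p + p * t) ^ card V"
  using assms
proof (induction V rule: finite_induct)
  case (insert x V)
  have "rs_expect V p (\<lambda>E. t ^ card (insert x E)) = rs_expect V p (\<lambda>E. t * t ^ card E)"
  proof (intro rs_expect_cong)
    fix E assume "E \<subseteq> V"
    then have "finite E" "x \<notin> E" using insert.hyps by (auto intro: finite_subset)
    then show "t ^ card (insert x E) = t * t ^ card E" by simp
  qed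
  then show ?case
    using insert by (simp add: rs_expect_insert rs_expect_cmult) (simp add: algebra_simps)
qed simp

lemma rs_expect_if_hit:
  assumes "finite B"
  shows "rs_expect B p (\<lambda>E. if E \<inter> B = {} then a else b) = (1 - p) ^ card B * a + (1 - (1 - p) ^ card B) * b"
proof -
  have "rs_prob B p (\<lambda>E. E \<inter> B = {}) = (1 - p) ^ card B"
    using rs_prob_contains_avoids[of B "{}" B p] assms by simp
  moreover have "rs_expect B p (\<lambda>E. if E \<inter> B = {} then a else b)
      = rs_expect B p (\<lambda>E. b + (a - b) * of_bool (E \<inter> B = {}))"
    by (intro rs_expect_cong) auto
  moreover have "\<dots> = b + (a - b) * rs_prob B p (\<lambda>E. E \<inter> B = {})"
    unfolding rs_expect_add rs_expect_cmult rs_expect_const[OF assms] ..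
  ultimately show ?thesis
    by (simp add: algebra_simps)
qed

text \<open>Disjoint blocks of \<open>b\<close> elements are missed independently, each with
  probability \<open>(1 - p) ^ b\<close>, so the indices of the hit blocks again form a random
  subset. This is the passage from random edges to the random set of segments that a connector
  touches.\<close>

lemma rs_expect_hit:
  assumes "finite K" "\<And>i. i \<in> K \<Longrightarrow> finite (B i) \<and> card (B i) = b" "disjoint_family_on B K"
  shows "rs_expect (\<Union>i\<in>K. B i) p (\<lambda>E. g {i\<in>K. E \<inter> B i \<noteq> {}}) = rs_expect K (1 - (1 - p) ^ b) g"
  using assms
proof (induction K arbitrary: g rule: finite_induct)
  case (insert x K)
  have disj: "B x \<inter> (\<Union>i\<in>K. B i) = {}"
    using disjoint_family_onD[OF insert.prems(2), of x] insert.hyps by fastforce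
  have fin: "finite (B x)" "finite (\<Union>i\<in>K. B i)" "card (B x) = b"
    using insert.prems(1) insert.hyps by auto
  have dK: "disjoint_family_on B K"
    using insert.prems(2) by (rule disjoint_family_on_mono[rotated]) auto
  let ?h = "\<lambda>h. rs_expect (\<Union>i\<in>K. B i) p (\<lambda>Y. h {i\<in>K. Y \<inter> B i \<noteq> {}})"
  have IH: "?h h = rs_expect K (1 - (1 - p) ^ b) h" for h
    using insert.prems dK by (intro insert.IH) auto
  have "rs_expect (B x \<union> (\<Union>i\<in>K. B i)) p (\<lambda>E. g {i\<in>insert x K. E \<inter> B i \<noteq> {}})
      = rs_expect (B x) p (\<lambda>X. rs_expect (\<Union>i\<in>K. B i) p (\<lambda>Y. g {i\<in>insert x K. (X \<union> Y) \<inter> B i \<noteq> {}}))"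
    by (intro rs_expect_Un fin disj)
  also have "\<dots> = rs_expect (B x) p (\<lambda>X. if X \<inter> B x = {} then ?h g else ?h (\<lambda>N. g (insert x N)))"
  proof (intro rs_expect_cong)
    fix X assume X: "X \<subseteq> B x"
    have "{i \<in> insert x K. (X \<union> Y) \<inter> B i \<noteq> {}}
        = (if X \<inter> B x = {} then {i\<in>K. Y \<inter> B i \<noteq> {}} else insert x {i\<in>K. Y \<inter> B i \<noteq> {}})"
      if Y: "Y \<subseteq> (\<Union>i\<in>K. B i)" for Y
    proof -
      have "i \<in> K \<Longrightarrow> X \<inter> B i = {}" for i using X disj by blast
      moreover have "Y \<inter> B x = {}" using Y disj by blast
      ultimately show ?thesis by (auto simp: Int_Un_distrib2)
    qed
    then show "rs_expect (\<Union>i\<in>K. B i) p (\<lambda>Y. g {i \<in> insert x K. (X \<union> Y) \<inter> B i \<noteq> {}})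
        = (if X \<inter> B x = {} then ?h g else ?h (\<lambda>N. g (insert x N)))"
      by (cases "X \<inter> B x = {}") (simp_all cong: rs_expect_cong)
  qed
  also have "\<dots> = (1 - p) ^ b * ?h g + (1 - (1 - p) ^ b) * ?h (\<lambda>N. g (insert x N))"
    using rs_expect_if_hit[OF fin(1)] fin(3) by simp
  finally show ?case
    by (simp only: IH[of g] IH[of "\<lambda>N. g (insert x N)"] UN_insert rs_expect_insert[OF insert.hyps]) simp
qed simp

lemma rs_expect_prod:
  assumes "finite J" "\<And>x. x \<in> J \<Longrightarrow> finite (C x)" "disjoint_family_on C J"
  shows "rs_expect (\<Union>x\<in>J. C x) p (\<lambda>E. \<Prod>x\<in>J. g x (E \<inter> C x)) = (\<Prod>x\<in>J. rs_expect (C x) p (g x))"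
  using assms
proof (induction J rule: finite_induct)
  case (insert x J)
  have disj: "C x \<inter> (\<Union>i\<in>J. C i) = {}"
    using disjoint_family_onD[OF insert.prems(2), of x] insert.hyps by fastforce
  have dJ: "disjoint_family_on C J"
    using insert.prems(2) by (rule disjoint_family_on_mono[rotated]) auto
  have "rs_expect (C x \<union> (\<Union>i\<in>J. C i)) p (\<lambda>E. \<Prod>y\<in>insert x J. g y (E \<inter> C y))
      = rs_expect (C x) p (\<lambda>X. rs_expect (\<Union>i\<in>J. C i) p (\<lambda>Y. \<Prod>y\<in>insert x J. g y ((X \<union> Y) \<inter> C y)))"
    using insert.prems insert.hyps disj by (intro rs_expect_Un) auto
  also have "\<dots> = rs_expect (C x) p (\<lambda>X. rs_expect (\<Union>i\<in>J. C i) p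
      (\<lambda>Y. g x X * (\<Prod>y\<in>J. g y (Y \<inter> C y))))"
  proof (intro rs_expect_cong)
    fix X Y assume X: "X \<subseteq> C x" and Y: "Y \<subseteq> (\<Union>i\<in>J. C i)"
    have "(X \<union> Y) \<inter> C x = X" using X Y disj by blast
    moreover have "(X \<union> Y) \<inter> C y = Y \<inter> C y" if "y \<in> J" for y using that X disj by blast
    ultimately show "(\<Prod>y\<in>insert x J. g y ((X \<union> Y) \<inter> C y)) = g x X * (\<Prod>y\<in>J. g y (Y \<inter> C y))"
      using insert.hyps by simp
  qed
  also have "\<dots> = rs_expect (C x) p (\<lambda>X. (\<Prod>y\<in>J. rs_expect (C y) p (g y)) * g x X)"
    using insert.prems dJ by (simp add: rs_expect_cmult insert.IH mult.commute)
  also have "\<dots> = (\<Prod>y\<in>insert x J. rs_expect (C y) p (g y))"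
    unfolding rs_expect_cmult using insert.hyps by simp
  finally show ?case
    by simp
qed simp

section \<open>Weighted counting of small subsets\<close>

lemma sum_power_card_Pow:
  fixes y :: real
  assumes "finite X"
  shows "(\<Sum>A\<in>Pow X. y ^ card A) = (1 + y) ^ card X"
proof -
  \<comment> \<open>For the parameter 1/2 all subsets have the same weight, so
    \<open>rs_expect_power_card\<close> evaluates the unweighted sum.\<close>
  have "rs_expect X (1/2) (\<lambda>E. y ^ card E) = (\<Sum>E\<in>Pow X. (1/2) ^ card X * y ^ card E)"
    unfolding rs_expect_def
  proof (intro sum.cong refl)
    fix E assume "E \<in> Pow X"
    then have "card E \<le> card X" using assms card_mono by blast
    then show "(1/2) ^ card E * (1 - 1/2) ^ (card X - card E) * y ^ card E = (1/2) ^ card X * y ^ card E"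
      by (simp flip: power_add)
  qed
  then have "(1/2) ^ card X * (\<Sum>A\<in>Pow X. y ^ card A) = (1/2 * (1 + y)) ^ card X"
    using rs_expect_power_card[OF assms, of "1/2" y]
    by (simp add: sum_distrib_left field_simps)
  then show ?thesis by (simp add: power_mult_distrib power_divide)
qed

text \<open>Each \<open>A\<close> in the truncated sum is given the weight \<open>(1 / y) ^ m * y ^ card A \<ge> 1\<close>.\<close>

lemma sum_power_card_le:
  fixes y z :: real
  assumes "finite X" "0 < y" "y \<le> 1" "0 \<le> z"
  shows "(\<Sum>A\<in>{A. A \<subseteq> X \<and> card A \<le> m}. z ^ card A) \<le> (1 / y) ^ m * (1 + z * y) ^ card X"
proof -
  have "(\<Sum>A\<in>{A. A \<subseteq> X \<and> card A \<le> m}. z ^ card A)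
      \<le> (\<Sum>A\<in>{A. A \<subseteq> X \<and> card A \<le> m}. (1 / y) ^ m * (z * y) ^ card A)"
  proof (intro sum_mono)
    fix A assume "A \<in> {A. A \<subseteq> X \<and> card A \<le> m}"
    then have "y ^ m \<le> y ^ card A" using assms by (auto intro: power_decreasing)
    then have "1 \<le> (1 / y) ^ m * y ^ card A" using assms by (simp add: field_simps)
    then have "z ^ card A * 1 \<le> z ^ card A * ((1 / y) ^ m * y ^ card A)"
      using assms by (intro mult_left_mono) auto
    then show "z ^ card A \<le> (1 / y) ^ m * (z * y) ^ card A"
      by (simp add: power_mult_distrib mult_ac)
  qed
  also have "\<dots> \<le> (\<Sum>A\<in>Pow X. (1 / y) ^ m * (z * y) ^ card A)"
    using assms by (intro sum_mono2) auto
  finally show ?thesis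
    using sum_power_card_Pow[OF assms(1)] by (simp flip: sum_distrib_left)
qed

lemma card_small_subsets_le:
  fixes y :: real
  assumes "finite X" "0 < y" "y \<le> 1"
  shows "real (card {A. A \<subseteq> X \<and> card A \<le> m}) \<le> (1 / y) ^ m * (1 + y) ^ card X"
  using sum_power_card_le[OF assms, of 1 m] by simp

text \<open>The left side is the probability that a random vertex set contains both pairs. The three
  terms stand for equal pairs, pairs with a common vertex and disjoint pairs; the middle one is a
  sum over vertices so that summation over \<open>e'\<close> produces degrees.\<close>

lemma power_card_Un_pairs_le:
  fixes q :: real
  assumes "card e = 2" "card e' = 2" "0 \<le> q" "q \<le> 1"
  shows "q ^ card (e \<union> e') \<le> of_bool (e' = e) * q ^ 2 + (\<Sum>v\<in>e. of_bool (v \<in> e') * q ^ 3) + q ^ 4"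
proof -
  obtain a b where e: "e = {a, b}" "a \<noteq> b" using assms(1) by (auto simp: card_2_iff)
  obtain c d where e': "e' = {c, d}" "c \<noteq> d" using assms(2) by (auto simp: card_2_iff)
  have nonneg: "0 \<le> q ^ 2" "0 \<le> q ^ 3" "0 \<le> q ^ 4" using assms by auto
  consider "a \<in> e'" "b \<in> e'" | "a \<in> e'" "b \<notin> e'" | "a \<notin> e'" "b \<in> e'" | "a \<notin> e'" "b \<notin> e'" by blast
  then show ?thesis
  proof cases
    case 1
    then have "e' = e" using e e' by auto
    then show ?thesis using assms nonneg by (simp add: sum_nonneg)
  next
    case 2
    then have "e \<inter> e' = {a}" using e by auto
    then have "card (e \<union> e') = 3" using card_Un_Int[of e e'] assms(1,2) e e' by simp
    then show ?thesis using 2 e nonneg by simp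
  next
    case 3
    then have "e \<inter> e' = {b}" using e by auto
    then have "card (e \<union> e') = 3" using card_Un_Int[of e e'] assms(1,2) e e' by simp
    then show ?thesis using 3 e nonneg by simp
  next
    case 4
    then have "e \<inter> e' = {}" using e by auto
    then have "card (e \<union> e') = 4" using card_Un_Int[of e e'] assms(1,2) e e' by simp
    then show ?thesis using 4 e nonneg by simp
  qed
qed

text \<open>Chebyshev's inequality for the number of edges spanned by a random vertex subset.\<close>

lemma rs_prob_independent_le:
  fixes q D :: real
  assumes K: "finite K" and U: "finite U" "U \<noteq> {}" "\<And>e. e \<in> U \<Longrightarrow> e \<subseteq> K \<and> card e = 2"
    and deg: "\<And>v. v \<in> K \<Longrightarrow> real (card {e\<in>U. v \<in> e}) \<le> D"
    and q: "0 < q" "q \<le> 1"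
  shows "rs_prob K q (\<lambda>N. \<not> (\<exists>e\<in>U. e \<subseteq> N)) \<le> (1 + 2 * D * q) / (card U * q\<^sup>2)"
proof -
  define u where "u = real (card U)"
  define \<mu> where "\<mu> = u * q\<^sup>2"
  define X :: "'a set \<Rightarrow> real" where "X = (\<lambda>N. \<Sum>e\<in>U. of_bool (e \<subseteq> N))"
  have u: "u > 0" using U by (simp add: u_def card_gt_0_iff)
  have \<mu>: "\<mu> > 0" using u q by (simp add: \<mu>_def)
  have contains: "rs_prob K q (\<lambda>N. A \<subseteq> N) = q ^ card A" if "A \<subseteq> K" for A
    using rs_prob_contains[OF K that] .
  have EX: "rs_expect K q X = \<mu>"
  proof -
    have "rs_expect K q X = (\<Sum>e\<in>U. q\<^sup>2)"
      unfolding X_def rs_expect_sum using U(3) contains by (intro sum.cong) auto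
    then show ?thesis by (simp add: \<mu>_def u_def)
  qed
  \<comment> \<open>Summed over \<open>e'\<close>, the middle term becomes the degrees of the two
    ends of \<open>e\<close>, each at most \<open>D\<close>.\<close>
  have inner: "(\<Sum>e'\<in>U. q ^ card (e \<union> e')) \<le> q ^ 2 + 2 * D * q ^ 3 + u * q ^ 4" if e: "e \<in> U" for e
  proof -
    have "(\<Sum>e'\<in>U. q ^ card (e \<union> e'))
        \<le> (\<Sum>e'\<in>U. of_bool (e' = e) * q ^ 2 + (\<Sum>v\<in>e. of_bool (v \<in> e') * q ^ 3) + q ^ 4)"
      using U(3) e q by (intro sum_mono power_card_Un_pairs_le) auto
    also have "\<dots> = (\<Sum>e'\<in>U. of_bool (e' = e)) * q ^ 2
        + (\<Sum>v\<in>e. (\<Sum>e'\<in>U. of_bool (v \<in> e')) * q ^ 3) + u * q ^ 4"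
      unfolding sum.distrib sum_distrib_right u_def
      by (subst sum.swap) simp
    also have "(\<Sum>e'\<in>U. of_bool (e' = e)) = (1::real)"
      using e U(1) by (simp add: of_bool_def)
    also have "(\<Sum>v\<in>e. (\<Sum>e'\<in>U. of_bool (v \<in> e')) * q ^ 3) \<le> (\<Sum>v\<in>e. D * q ^ 3)"
    proof (intro sum_mono mult_right_mono)
      fix v assume "v \<in> e"
      then have "v \<in> K" using U(3) e by auto
      have "(\<Sum>e'\<in>U. of_bool (v \<in> e')) = real (card {e\<in>U. v \<in> e})"
        using U(1) by (simp add: of_bool_def sum.If_cases Int_def)
      then show "(\<Sum>e'\<in>U. of_bool (v \<in> e')) \<le> D" using deg[OF \<open>v \<in> K\<close>] by simp
    qed (use q in auto)
    also have "(\<Sum>v\<in>e. D * q ^ 3) = 2 * D * q ^ 3" using U(3) e by simp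
    finally show ?thesis by simp
  qed
  have EXX: "rs_expect K q (\<lambda>N. X N * X N) \<le> u * (q ^ 2 + 2 * D * q ^ 3 + u * q ^ 4)"
  proof -
    have "rs_expect K q (\<lambda>N. X N * X N)
        = rs_expect K q (\<lambda>N. \<Sum>e\<in>U. \<Sum>e'\<in>U. of_bool (e \<union> e' \<subseteq> N))"
      unfolding X_def sum_product by (intro rs_expect_cong sum.cong refl) auto
    also have "\<dots> = (\<Sum>e\<in>U. \<Sum>e'\<in>U. q ^ card (e \<union> e'))"
      unfolding rs_expect_sum using U(3) by (intro sum.cong refl contains) blast
    also have "\<dots> \<le> (\<Sum>e\<in>U. q ^ 2 + 2 * D * q ^ 3 + u * q ^ 4)"
      by (intro sum_mono inner)
    finally show ?thesis by (simp add: u_def)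
  qed
  \<comment> \<open>If no pair is spanned then \<open>X N = 0\<close>, and the squared deviation of
    \<open>X\<close> from its mean equals the square of \<open>\<mu>\<close>. Comparing expectations
    is Chebyshev's inequality.\<close>
  have "\<mu>\<^sup>2 * rs_prob K q (\<lambda>N. \<not> (\<exists>e\<in>U. e \<subseteq> N)) = rs_expect K q (\<lambda>N. \<mu>\<^sup>2 * of_bool (\<not> (\<exists>e\<in>U. e \<subseteq> N)))"
    by (simp only: rs_expect_cmult)
  also have "\<dots> \<le> rs_expect K q (\<lambda>N. (X N * X N + (- 2 * \<mu>) * X N) + \<mu>\<^sup>2)"
  proof (intro rs_expect_mono)
    fix N
    have "X N = 0" if "\<not> (\<exists>e\<in>U. e \<subseteq> N)" using that unfolding X_def by (intro sum.neutral) auto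
    moreover have "X N * X N + (- 2 * \<mu>) * X N + \<mu>\<^sup>2 = (X N - \<mu>)\<^sup>2"
      by (simp add: power2_eq_square algebra_simps)
    ultimately show "\<mu>\<^sup>2 * of_bool (\<not> (\<exists>e\<in>U. e \<subseteq> N)) \<le> X N * X N + (- 2 * \<mu>) * X N + \<mu>\<^sup>2"
      by (cases "\<exists>e\<in>U. e \<subseteq> N") auto
  qed (use q in auto)
  also have "\<dots> = rs_expect K q (\<lambda>N. X N * X N) + (- 2 * \<mu>) * \<mu> + \<mu>\<^sup>2"
    unfolding rs_expect_add rs_expect_cmult rs_expect_const[OF K] EX ..
  also have "\<dots> \<le> u * (q ^ 2 + 2 * D * q ^ 3 + u * q ^ 4) - \<mu>\<^sup>2"
    using EXX by (simp add: power2_eq_square)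
  also have "\<dots> = \<mu> * (1 + 2 * D * q)"
    by (simp add: \<mu>_def power2_eq_square power3_eq_cube power4_eq_xxxx algebra_simps)
  finally have "\<mu> * (\<mu> * rs_prob K q (\<lambda>N. \<not> (\<exists>e\<in>U. e \<subseteq> N))) \<le> \<mu> * (1 + 2 * D * q)"
    by (simp add: power2_eq_square mult.assoc)
  then have "\<mu> * rs_prob K q (\<lambda>N. \<not> (\<exists>e\<in>U. e \<subseteq> N)) \<le> 1 + 2 * D * q"
    using \<mu> by simp
  then show ?thesis
    using \<mu> by (simp add: \<mu>_def u_def field_simps)
qed

text \<open>The case distinction is needed because the lower bound \<open>2048 / 2 ^ s\<close> on \<open>q\<close> exceeds 1 for small \<open>s\<close>.\<close>

lemma rs_prob_independent_le_16:
  fixes q :: real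
  assumes K: "finite K" and U: "finite U" "\<And>e. e \<in> U \<Longrightarrow> e \<subseteq> K \<and> card e = 2"
    and card_U: "4 ^ s < 4 * card U"
    and deg: "\<And>v. v \<in> K \<Longrightarrow> card {e\<in>U. v \<in> e} \<le> 8 * 2 ^ s"
    and q: "1 - exp (- (8192 / 2 ^ s)) \<le> q" "q \<le> 1"
  shows "rs_prob K q (\<lambda>N. \<not> (\<exists>e\<in>U. e \<subseteq> N)) \<le> 1 / 16"
proof -
  \<comment> \<open>The exponent is \<open>4 * x\<close>; the factor 4 is the slack that makes
    \<open>1 - exp (- (4 * x))\<close> at least \<open>x\<close> as long as
    \<open>x \<le> 1 / 2\<close>.\<close>
  define x :: real where "x = 2048 / 2 ^ s"
  have x: "x > 0" by (simp add: x_def)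
  have q0: "1 - exp (- (4 * x)) \<le> q" using q by (simp add: x_def)
  have "exp (- (4 * x)) < 1" using x by simp
  then have qpos: "0 < q" using q0 by linarith
  have ne: "U \<noteq> {}" using card_U by auto
  show ?thesis
  proof (cases "x \<le> 1 / 2")
    case True
    have "exp (- (4 * x)) \<le> 1 / (1 + 4 * x)"
      using exp_ge_add_one_self[of "4 * x"] x by (simp add: exp_minus field_simps)
    also have "\<dots> \<le> 1 - x"
    proof -
      have "0 \<le> x * (3 - 4 * x)" using x True by (intro mult_nonneg_nonneg) auto
      then show ?thesis using x by (simp add: field_simps)
    qed
    finally have xq: "x \<le> q" using q0 by linarith
    have u: "(2 ^ s)\<^sup>2 / 4 < real (card U)"
    proof -
      have "real (4 ^ s) < real (4 * card U)" using card_U by (rule less_imp_of_nat_less)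
      moreover have "real (4 ^ s) = (2 ^ s)\<^sup>2" by (simp add: power_mult[symmetric] mult.commute[of s 2] power_mult)
      ultimately show ?thesis by simp
    qed
    have sx: "2 ^ s = 2048 / x" using x by (simp add: x_def)
    have uq: "1048576 / x \<le> u * q" if "u = real (card U)" for u
    proof -
      have "1048576 / x\<^sup>2 \<le> u" using u that by (simp add: sx power_divide)
      then have "1048576 / x\<^sup>2 * x \<le> u * q" using xq x that by (intro mult_mono) auto
      then show ?thesis using x by (simp add: power2_eq_square)
    qed
    have "rs_prob K q (\<lambda>N. \<not> (\<exists>e\<in>U. e \<subseteq> N)) \<le> (1 + 2 * (8 * 2 ^ s) * q) / (card U * q\<^sup>2)"
    proof (rule rs_prob_independent_le[OF K U(1) ne U(2) _ qpos q(2)])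
      fix v assume "v \<in> K"
      from deg[OF this] have "real (card {e\<in>U. v \<in> e}) \<le> real (8 * 2 ^ s)" by (rule of_nat_mono)
      then show "real (card {e\<in>U. v \<in> e}) \<le> 8 * 2 ^ s" by simp
    qed
    also have "\<dots> \<le> 1 / 16"
    proof -
      define w where "w = real (card U) * q"
      have w: "1048576 / x \<le> w" using uq by (simp add: w_def)
      have "16 * (1 + 16 * (2048 / x) * q) \<le> (1048576 / x) * q"
      proof -
        have "16 * x \<le> 524288 * q" using xq x by simp
        then show ?thesis using x by (simp add: field_simps)
      qed
      also have "\<dots> \<le> w * q" using w qpos by (intro mult_right_mono) auto
      finally have "16 * (1 + 16 * 2 ^ s * q) \<le> card U * q\<^sup>2"
        by (simp add: sx w_def power2_eq_square mult.assoc)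
      then show ?thesis using qpos ne U(1) by (simp add: divide_le_eq card_gt_0_iff)
    qed
    finally show ?thesis .
  next
    case False
    \<comment> \<open>Since 2048 is the 11th power of 2, \<open>x > 1 / 2\<close> forces
      \<open>s \<le> 11\<close> and therefore \<open>x \<ge> 1\<close>. Then \<open>q\<close> is at
      least 31/32, and a single pair of \<open>U\<close> is spanned with probability above
      15/16.\<close>
    have "\<not> 12 \<le> s"
    proof
      assume "12 \<le> s"
      then have "(2::real) ^ 12 \<le> 2 ^ s" by (intro power_increasing) auto
      then show False using False by (simp add: x_def field_simps)
    qed
    then have "(2::real) ^ s \<le> 2 ^ 11" by (intro power_increasing) auto
    then have "1 \<le> x" by (simp add: x_def field_simps)
    have "(5 / 2) ^ 4 \<le> exp (1::real) ^ 4"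
      using exp_lower_Taylor_quadratic[of 1] by (intro power_mono) auto
    also have "\<dots> = exp 4" by (simp flip: exp_of_nat_mult)
    also have "\<dots> \<le> exp (4 * x)" using \<open>1 \<le> x\<close> by simp
    finally have "exp (- (4 * x)) \<le> 1 / 32"
      by (simp add: exp_minus field_simps)
    then have q1: "1 - 1 / 32 \<le> q" using q0 by linarith
    obtain e where e: "e \<in> U" using ne by auto
    have "rs_prob K q (\<lambda>N. \<not> (\<exists>e\<in>U. e \<subseteq> N)) \<le> rs_prob K q (\<lambda>N. \<not> e \<subseteq> N)"
      using e q qpos by (intro rs_expect_mono) (auto simp: of_bool_def)
    also have "\<dots> = 1 - q\<^sup>2"
      using rs_prob_contains[OF K, of e q] U(2)[OF e] by (simp add: rs_prob_not[OF K])
    also have "\<dots> \<le> 1 / 16"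
      using mult_mono[OF q1 q1] qpos by (simp add: power2_eq_square)
    finally show ?thesis .
  qed
qed

text \<open>A union bound over the \<open>M\<close>-subsets of failing blocks.\<close>

lemma rs_prob_many_failures_le:
  assumes C: "\<And>x. x < 2 * M \<Longrightarrow> finite (C x)" "disjoint_family_on C {..<2 * M}"
    and V: "finite V" "(\<Union>x<2 * M. C x) \<subseteq> V"
    and p: "0 \<le> p" "p \<le> 1"
    and fail: "\<And>x. x < 2 * M \<Longrightarrow> rs_prob (C x) p (F x) \<le> 1 / 16"
  shows "rs_prob V p (\<lambda>E. M \<le> card {x\<in>{..<2 * M}. F x (E \<inter> C x)}) \<le> (1 / 4) ^ M"
proof -
  define \<J> where "\<J> = {J. J \<subseteq> {..<2 * M} \<and> card J = M}"
  have fin: "finite \<J>" unfolding \<J>_def by (rule finite_subset[of _ "Pow {..<2 * M}"]) auto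
  have "rs_prob V p (\<lambda>E. M \<le> card {x\<in>{..<2 * M}. F x (E \<inter> C x)})
      \<le> rs_expect V p (\<lambda>E. \<Sum>J\<in>\<J>. \<Prod>x\<in>J. of_bool (F x (E \<inter> C x)))"
  proof (intro rs_expect_mono p)
    fix E
    have nonneg: "0 \<le> (\<Sum>J\<in>\<J>. \<Prod>x\<in>J. of_bool (F x (E \<inter> C x)) :: real)"
      by (intro sum_nonneg prod_nonneg) auto
    have "1 \<le> (\<Sum>J\<in>\<J>. \<Prod>x\<in>J. of_bool (F x (E \<inter> C x)) :: real)"
      if many: "M \<le> card {x\<in>{..<2 * M}. F x (E \<inter> C x)}"
    proof -
      obtain J where J: "J \<subseteq> {x\<in>{..<2 * M}. F x (E \<inter> C x)}" "card J = M"
        by (rule obtain_subset_with_card_n[OF many])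
      then have "J \<in> \<J>" by (auto simp: \<J>_def)
      have "(\<Prod>x\<in>J. of_bool (F x (E \<inter> C x)) :: real) = 1"
        using J by (intro prod.neutral) auto
      then show ?thesis
        using member_le_sum[OF \<open>J \<in> \<J>\<close> _ fin, of "\<lambda>J. \<Prod>x\<in>J. of_bool (F x (E \<inter> C x)) :: real"]
        by (simp add: prod_nonneg)
    qed
    then show "of_bool (M \<le> card {x\<in>{..<2 * M}. F x (E \<inter> C x)})
        \<le> (\<Sum>J\<in>\<J>. \<Prod>x\<in>J. of_bool (F x (E \<inter> C x)) :: real)"
      using nonneg by (cases "M \<le> card {x\<in>{..<2 * M}. F x (E \<inter> C x)}") (simp_all only: of_bool_eq)
  qed
  also have "\<dots> = (\<Sum>J\<in>\<J>. rs_expect V p (\<lambda>E. \<Prod>x\<in>J. of_bool (F x (E \<inter> C x))))"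
    by (rule rs_expect_sum)
  also have "\<dots> \<le> (\<Sum>J\<in>\<J>. (1 / 16) ^ M)"
  proof (intro sum_mono)
    fix J assume "J \<in> \<J>"
    then have J: "J \<subseteq> {..<2 * M}" "card J = M" "finite J" by (auto simp: \<J>_def intro: finite_subset)
    have "rs_expect V p (\<lambda>E. \<Prod>x\<in>J. of_bool (F x (E \<inter> C x)))
        = rs_expect V p (\<lambda>E. \<Prod>x\<in>J. of_bool (F x (E \<inter> (\<Union>x\<in>J. C x) \<inter> C x)))"
    proof (intro rs_expect_cong prod.cong refl)
      fix E x assume "x \<in> J"
      then have "E \<inter> (\<Union>x\<in>J. C x) \<inter> C x = E \<inter> C x" by blast
      then show "of_bool (F x (E \<inter> C x)) = (of_bool (F x (E \<inter> (\<Union>x\<in>J. C x) \<inter> C x)) :: real)"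
        by simp
    qed
    also have "\<dots> = rs_expect (\<Union>x\<in>J. C x) p (\<lambda>E. \<Prod>x\<in>J. of_bool (F x (E \<inter> C x)))"
      using V J by (intro rs_expect_restrict[where g = "\<lambda>E. \<Prod>x\<in>J. of_bool (F x (E \<inter> C x))"]) auto
    also have "\<dots> = (\<Prod>x\<in>J. rs_prob (C x) p (F x))"
      using J C disjoint_family_on_mono[OF J(1) C(2)] by (intro rs_expect_prod) auto
    also have "\<dots> \<le> (\<Prod>x\<in>J. 1 / 16)"
      using J fail p by (intro prod_mono conjI rs_expect_nonneg) auto
    finally show "rs_expect V p (\<lambda>E. \<Prod>x\<in>J. of_bool (F x (E \<inter> C x))) \<le> (1 / 16) ^ M"
      using J by simp
  qed
  \<comment> \<open>There are at most \<open>4 ^ M\<close> sets of blocks, and a fixed set fails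
    entirely with probability at most \<open>(1 / 16) ^ M\<close>.\<close>
  also have "\<dots> \<le> real (2 ^ (2 * M)) * (1 / 16) ^ M"
  proof -
    have "card \<J> \<le> card (Pow {..<2 * M})"
      unfolding \<J>_def by (intro card_mono) auto
    then have "card \<J> \<le> 2 ^ (2 * M)" by (simp add: card_Pow)
    then have "real (card \<J>) \<le> real (2 ^ (2 * M))" by (rule of_nat_mono)
    then show ?thesis by simp
  qed
  also have "\<dots> = (1 / 4) ^ M"
    by (simp add: power_mult flip: power_mult_distrib)
  finally show ?thesis .
qed

section \<open>Complete minors and depth-first search\<close>

lemma connected_in_singleton: "connected_in E {x}"
  by (auto simp: connected_in_def)

lemma connected_in_mono: "connected_in E B \<Longrightarrow> E \<subseteq> E' \<Longrightarrow> connected_in E' B"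
proof -
  assume B: "connected_in E B" and "E \<subseteq> E'"
  then have "{(x, y). x \<in> B \<and> y \<in> B \<and> {x, y} \<in> E}\<^sup>* \<subseteq> {(x, y). x \<in> B \<and> y \<in> B \<and> {x, y} \<in> E'}\<^sup>*"
    by (intro rtrancl_mono) auto
  then show "connected_in E' B"
    using B unfolding connected_in_def by blast
qed

lemma connected_in_Un:
  assumes A: "connected_in E A" and B: "connected_in E B"
    and ab: "a \<in> A" "b \<in> B" "{a, b} \<in> E"
  shows "connected_in E (A \<union> B)"
proof -
  let ?r = "\<lambda>C. {(x, y). x \<in> C \<and> y \<in> C \<and> {x, y} \<in> E}"
  have mono: "(?r A)\<^sup>* \<subseteq> (?r (A \<union> B))\<^sup>*" "(?r B)\<^sup>* \<subseteq> (?r (A \<union> B))\<^sup>*"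
    by (rule rtrancl_mono; auto)+
  have edge: "(a, b) \<in> (?r (A \<union> B))\<^sup>*" "(b, a) \<in> (?r (A \<union> B))\<^sup>*"
    using ab by (auto intro!: r_into_rtrancl simp: insert_commute)
  have "(u, a) \<in> (?r (A \<union> B))\<^sup>* \<and> (a, u) \<in> (?r (A \<union> B))\<^sup>*" if "u \<in> A \<union> B" for u
  proof (cases "u \<in> A")
    case True
    then have "(u, a) \<in> (?r A)\<^sup>*" "(a, u) \<in> (?r A)\<^sup>*"
      using A ab(1) unfolding connected_in_def by blast+
    then show ?thesis using mono(1) by blast
  next
    case False
    then have "(u, b) \<in> (?r B)\<^sup>*" "(b, u) \<in> (?r B)\<^sup>*"
      using that B ab(2) unfolding connected_in_def by blast+
    then have "(u, b) \<in> (?r (A \<union> B))\<^sup>*" "(b, u) \<in> (?r (A \<union> B))\<^sup>*"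
      using mono(2) by blast+
    then show ?thesis using edge by (meson rtrancl_trans)
  qed
  then have "(u, v) \<in> (?r (A \<union> B))\<^sup>*" if "u \<in> A \<union> B" "v \<in> A \<union> B" for u v
    using that by (meson rtrancl_trans)
  then show ?thesis
    using A unfolding connected_in_def by blast
qed

lemma connected_in_UN:
  assumes "finite J" "connected_in E A"
    and "\<And>j. j \<in> J \<Longrightarrow> connected_in E (B j) \<and> (\<exists>x\<in>A. \<exists>y\<in>B j. {x, y} \<in> E)"
  shows "connected_in E (A \<union> (\<Union>j\<in>J. B j))"
  using assms
proof (induction J rule: finite_induct)
  case (insert j J)
  obtain x y where xy: "x \<in> A" "y \<in> B j" "{x, y} \<in> E"
    using insert.prems(2)[of j] by auto
  have "connected_in E ((A \<union> (\<Union>j\<in>J. B j)) \<union> B j)"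
    using xy insert.prems(2)[of j]
    by (intro connected_in_Un[of _ _ _ x y] insert.IH insert.prems(1,2)) auto
  moreover have "A \<union> (\<Union>j\<in>J. B j) \<union> B j = A \<union> (\<Union>j\<in>insert j J. B j)" by blast
  ultimately show ?case by simp
qed simp

lemma connected_in_path:
  assumes "xs \<noteq> []" "successively (\<lambda>x y. {x, y} \<in> E) xs"
  shows "connected_in E (set xs)"
  using assms
proof (induction xs rule: induct_list012)
  case (2 x)
  then show ?case by (simp add: connected_in_singleton)
next
  case (3 x y zs)
  then have "connected_in E ({x} \<union> set (y # zs))"
    by (intro connected_in_Un[of _ _ _ x y] connected_in_singleton) auto
  then show ?case by (simp add: insert_commute)
qed simp

text \<open>The pieces are cut off the front of the path one after another, and consecutive vertices
  of a path are connected. Prescribed lengths over an arbitrary finite index set allow segments and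
  connectors of all sizes to be cut from one path in a single application.\<close>

lemma path_pieces:
  assumes "finite I" "\<And>i. i \<in> I \<Longrightarrow> 1 \<le> a i" "sum a I \<le> length xs"
    and "distinct xs" "successively (\<lambda>x y. {x, y} \<in> E) xs"
  shows "\<exists>S. disjoint_family_on S I \<and>
    (\<forall>i\<in>I. S i \<subseteq> set xs \<and> card (S i) = a i \<and> connected_in E (S i))"
  using assms
proof (induction I arbitrary: xs rule: finite_induct)
  case empty
  then show ?case by (auto simp: disjoint_family_on_def)
next
  case (insert i I)
  define ys zs where "ys = take (a i) xs" and "zs = drop (a i) xs"
  have xs: "xs = ys @ zs" by (simp add: ys_def zs_def)
  have len: "length ys = a i" "sum a I \<le> length zs"
    using insert.prems insert.hyps by (auto simp: ys_def zs_def)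
  have succ: "successively (\<lambda>x y. {x, y} \<in> E) ys" "successively (\<lambda>x y. {x, y} \<in> E) zs"
    using insert.prems(4) unfolding xs by (auto simp: successively_append_iff)
  have dist: "distinct ys" "distinct zs" "set ys \<inter> set zs = {}"
    using insert.prems(3) unfolding xs by auto
  obtain S where S: "disjoint_family_on S I"
    "\<And>j. j \<in> I \<Longrightarrow> S j \<subseteq> set zs \<and> card (S j) = a j \<and> connected_in E (S j)"
    using insert.IH[OF _ len(2) dist(2) succ(2)] insert.prems(1) by auto
  have "ys \<noteq> []" using len insert.prems(1)[of i] by auto
  then have ys: "connected_in E (set ys)" "card (set ys) = a i"
    using succ(1) dist(1) len(1) by (auto intro: connected_in_path simp: distinct_card)
  let ?S = "S(i := set ys)"
  have "disjoint_family_on ?S (insert i I)"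
    using S dist(3) insert.hyps(2) unfolding disjoint_family_on_def by (auto; blast)
  moreover have "?S j \<subseteq> set xs \<and> card (?S j) = a j \<and> connected_in E (?S j)" if "j \<in> insert i I" for j
    using S(2)[of j] ys that unfolding xs by auto
  ultimately show ?case by blast
qed

text \<open>A state of depth-first search: \<open>W \<union> {..<b}\<close> is the set of visited vertices, \<open>W\<close> consists of
  the visited vertices that are not roots, \<open>f\<close> maps them to their parents, and \<open>us\<close> is the stack.
  New roots are chosen as small as possible, so the threshold \<open>b\<close> determines all of them.\<close>

definition dfs_state :: "nat \<Rightarrow> nat set set \<Rightarrow> nat \<Rightarrow> nat set \<Rightarrow> (nat \<Rightarrow> nat) \<Rightarrow> nat list \<Rightarrow> bool" where
  "dfs_state n E b W f us \<longleftrightarrow>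
     b \<le> n \<and> W \<subseteq> {..<n} \<and> f \<in> W \<rightarrow> W \<union> {..<b} \<and>
     inj_on (\<lambda>v. {v, f v}) W \<and> (\<forall>v\<in>W. f v \<noteq> v \<and> {v, f v} \<in> E) \<and>
     distinct us \<and> set us \<subseteq> W \<union> {..<b} \<and> successively (\<lambda>x y. {x, y} \<in> E) us \<and>
     (\<forall>x\<in>W \<union> {..<b} - set us. \<forall>y\<in>{..<n} - (W \<union> {..<b}). {x, y} \<notin> E)"

text \<open>Induction on the stack. An empty stack receives a new root. If the top vertex has an
  unvisited neighbour, that neighbour is pushed. Otherwise the top vertex is finished and popped;
  the visited set stays the same, and the induction hypothesis applies to the shorter stack.\<close>

lemma dfs_state_step:
  assumes "dfs_state n E b W f us" "card (W \<union> {..<b}) < n"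
  shows "\<exists>b' W' f' us'. dfs_state n E b' W' f' us' \<and> card (W' \<union> {..<b'}) = Suc (card (W \<union> {..<b}))"
  using assms
proof (induction us)
  case Nil
  note st = Nil.prems(1)[unfolded dfs_state_def]
  let ?X = "W \<union> {..<b}"
  have fin: "finite ?X" using st by (auto intro: finite_subset)
  have "\<exists>v. v < n \<and> v \<notin> ?X"
  proof (rule ccontr)
    assume "\<nexists>v. v < n \<and> v \<notin> ?X"
    then have "{..<n} \<subseteq> ?X" by blast
    then show False using card_mono[OF fin, of "{..<n}"] Nil.prems(2) by simp
  qed
  then obtain v where v: "v < n" "v \<notin> ?X" by blast
  \<comment> \<open>As \<open>r\<close> is the least unvisited vertex, raising the threshold to
    \<open>Suc r\<close> adds only \<open>r\<close> to the visited set.\<close>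
  define r where "r = (LEAST v. v \<notin> ?X)"
  have r: "r \<notin> ?X" unfolding r_def by (rule LeastI[of "\<lambda>v. v \<notin> ?X", OF v(2)])
  have "r \<le> v" unfolding r_def by (rule Least_le[of "\<lambda>v. v \<notin> ?X", OF v(2)])
  have below: "u \<in> ?X" if "u < r" for u using not_less_Least[of u "\<lambda>v. v \<notin> ?X"] that unfolding r_def by blast
  have X: "W \<union> {..<Suc r} = insert r ?X"
  proof (intro set_eqI iffI)
    fix v
    show "v \<in> W \<union> {..<Suc r} \<Longrightarrow> v \<in> insert r ?X" using below[of v] by (auto simp: less_Suc_eq)
    show "v \<in> insert r ?X \<Longrightarrow> v \<in> W \<union> {..<Suc r}" using r by auto
  qed
  have "dfs_state n E (Suc r) W f [r]"
    unfolding dfs_state_def X using st \<open>r \<le> v\<close> v by auto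
  moreover have "card (W \<union> {..<Suc r}) = Suc (card ?X)"
    unfolding X using fin r by simp
  ultimately show ?case by blast
next
  case (Cons u us)
  note st = Cons.prems(1)[unfolded dfs_state_def]
  let ?X = "W \<union> {..<b}"
  have fin: "finite ?X" using st by (auto intro: finite_subset)
  show ?case
  proof (cases "\<exists>w<n. w \<notin> ?X \<and> {u, w} \<in> E")
    case True
    then obtain w where w: "w < n" "w \<notin> ?X" "{u, w} \<in> E" by blast
    have X: "insert w W \<union> {..<b} = insert w ?X" by auto
    have u: "u \<in> ?X" "u \<noteq> w" using st w by auto
    have fX: "f v \<in> ?X" "v \<noteq> w" "f v \<noteq> w" "f v \<noteq> v" "{v, f v} \<in> E" if "v \<in> W" for v
      using st w that by auto
    let ?f = "f(w := u)"
    have "inj_on (\<lambda>v. {v, ?f v}) (insert w W)"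
    proof -
      have "inj_on (\<lambda>v. {v, f v}) W" using st by blast
      then have "inj_on (\<lambda>v. {v, ?f v}) W" using fX by (auto simp: inj_on_def)
      \<comment> \<open>The new parent edge contains \<open>w\<close>, which was unvisited, while
        all earlier parent edges lie inside the visited set.\<close>
      moreover have "{w, ?f w} \<notin> (\<lambda>v. {v, ?f v}) ` (W - {w})"
      proof
        assume "{w, ?f w} \<in> (\<lambda>v. {v, ?f v}) ` (W - {w})"
        then obtain v where v: "v \<in> W" "{w, u} = {v, f v}" by (auto split: if_splits)
        then have "w = v \<or> w = f v" by auto
        then show False using fX[OF v(1)] by auto
      qed
      ultimately show ?thesis by (simp add: inj_on_insert)
    qed
    moreover have "?f \<in> insert w W \<rightarrow> insert w ?X" using fX u by auto
    moreover have "\<forall>v\<in>insert w W. ?f v \<noteq> v \<and> {v, ?f v} \<in> E"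
      using fX u w(3) by (auto simp: insert_commute)
    moreover have "distinct (w # u # us)" "set (w # u # us) \<subseteq> insert w ?X"
      using st w by auto
    moreover have "successively (\<lambda>x y. {x, y} \<in> E) (w # u # us)"
      using st w(3) by (simp add: insert_commute)
    moreover have "\<forall>x\<in>insert w ?X - set (w # u # us). \<forall>y\<in>{..<n} - insert w ?X. {x, y} \<notin> E"
      using st by auto
    ultimately have "dfs_state n E b (insert w W) ?f (w # u # us)"
      unfolding dfs_state_def X using st w(1) by simp
    moreover have "card (insert w W \<union> {..<b}) = Suc (card ?X)"
      unfolding X using fin w by simp
    ultimately show ?thesis by blast
  next
    case False
    have "\<forall>x\<in>?X - set us. \<forall>y\<in>{..<n} - ?X. {x, y} \<notin> E"
    proof (intro ballI)
      fix x y assume xy: "x \<in> ?X - set us" "y \<in> {..<n} - ?X"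
      show "{x, y} \<notin> E"
      proof (cases "x = u")
        case True
        then show ?thesis using False xy by auto
      next
        case False
        then show ?thesis using st xy by auto
      qed
    qed
    moreover have "successively (\<lambda>x y. {x, y} \<in> E) us" using st by (cases us) auto
    ultimately have "dfs_state n E b W f us"
      unfolding dfs_state_def using st by simp
    then show ?thesis using Cons.IH Cons.prems(2) by blast
  qed
qed

lemma dfs_state_exists:
  assumes "s \<le> n"
  shows "\<exists>b W f us. dfs_state n E b W f us \<and> card (W \<union> {..<b}) = s"
  using assms
proof (induction s)
  case 0
  have "dfs_state n E 0 {} f []" for f by (auto simp: dfs_state_def)
  then show ?case by fastforce
next
  case (Suc s)
  then obtain b W f us where "dfs_state n E b W f us" "card (W \<union> {..<b}) = s" by auto
  then show ?case using dfs_state_step[of n E b W f us] Suc.prems by auto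
qed

section \<open>Complete minors and the Hadwiger number\<close>

lemma has_complete_minorI:
  assumes "\<And>i. i < k \<Longrightarrow> B i \<subseteq> {..<n}" "\<And>i. i < k \<Longrightarrow> connected_in E (B i)"
    and "\<And>i j. i < k \<Longrightarrow> j < k \<Longrightarrow> i \<noteq> j \<Longrightarrow> B i \<inter> B j = {}"
    and "\<And>i j. i < k \<Longrightarrow> j < k \<Longrightarrow> i \<noteq> j \<Longrightarrow> \<exists>x\<in>B i. \<exists>y\<in>B j. {x, y} \<in> E"
  shows "has_complete_minor n E k"
  unfolding has_complete_minor_def
  by (intro exI[of _ B] conjI allI impI; rule assms; assumption)

lemma has_complete_minorE:
  assumes "has_complete_minor n E k"
  obtains B where "\<And>i. i < k \<Longrightarrow> B i \<subseteq> {..<n}" "\<And>i. i < k \<Longrightarrow> connected_in E (B i)"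
    and "\<And>i j. i < k \<Longrightarrow> j < k \<Longrightarrow> i \<noteq> j \<Longrightarrow> B i \<inter> B j = {}"
    and "\<And>i j. i < k \<Longrightarrow> j < k \<Longrightarrow> i \<noteq> j \<Longrightarrow> \<exists>x\<in>B i. \<exists>y\<in>B j. {x, y} \<in> E"
  using assms[unfolded has_complete_minor_def]
proof (elim exE conjE)
  fix B
  assume B: "\<forall>i<k. B i \<subseteq> {..<n} \<and> connected_in E (B i)"
    "\<forall>i<k. \<forall>j<k. i \<noteq> j \<longrightarrow> B i \<inter> B j = {}"
    "\<forall>i<k. \<forall>j<k. i \<noteq> j \<longrightarrow> (\<exists>x\<in>B i. \<exists>y\<in>B j. {x, y} \<in> E)"
  show thesis by (rule that[of B]) (use B in simp_all)
qed

text \<open>Representatives of the branch sets are distinct vertices, so \<open>k \<le> n\<close>.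
  Finiteness is what makes the \<open>Max\<close> in \<open>ccl\<close> a genuine maximum.\<close>

lemma finite_has_complete_minor: "finite {k. has_complete_minor n E k}"
proof (rule finite_subset)
  show "{k. has_complete_minor n E k} \<subseteq> {..n}"
  proof
    fix k assume "k \<in> {k. has_complete_minor n E k}"
    then have "has_complete_minor n E k" by simp
    then obtain B where B: "\<And>i. i < k \<Longrightarrow> B i \<subseteq> {..<n}" "\<And>i. i < k \<Longrightarrow> connected_in E (B i)"
        "\<And>i j. i < k \<Longrightarrow> j < k \<Longrightarrow> i \<noteq> j \<Longrightarrow> B i \<inter> B j = {}"
      by (rule has_complete_minorE) blast
    define g where "g i = (SOME x. x \<in> B i)" for i
    have g: "g i \<in> B i" if "i < k" for i
      using B(2)[OF that] unfolding g_def connected_in_def some_in_eq by blast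
    have "inj_on g {..<k}"
      using g B(3) by (intro inj_onI) (metis IntI emptyE lessThan_iff)
    moreover have "g ` {..<k} \<subseteq> {..<n}" using g B(1) by auto
    ultimately have "card {..<k} \<le> card {..<n}" by (intro card_inj_on_le) auto
    then show "k \<in> {..n}" by simp
  qed
qed simp

lemma has_complete_minor_0: "has_complete_minor n E 0"
  by (simp add: has_complete_minor_def)

lemma has_complete_minor_ccl: "has_complete_minor n E (ccl n E)"
  using Max_in[OF finite_has_complete_minor] has_complete_minor_0 unfolding ccl_def by fastforce

lemma has_complete_minor_le_ccl: "has_complete_minor n E k \<Longrightarrow> k \<le> ccl n E"
  unfolding ccl_def by (intro Max_ge finite_has_complete_minor) simp

text \<open>Sending each vertex to the index of its branch set maps some edge onto every pair of
  indices, so there are at least as many edges as pairs.\<close>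

lemma has_complete_minor_edges:
  assumes "has_complete_minor n E k" "finite E"
  shows "k choose 2 \<le> card E"
proof -
  obtain B where disj: "\<And>i j. i < k \<Longrightarrow> j < k \<Longrightarrow> i \<noteq> j \<Longrightarrow> B i \<inter> B j = {}"
    and edge: "\<And>i j. i < k \<Longrightarrow> j < k \<Longrightarrow> i \<noteq> j \<Longrightarrow> \<exists>x\<in>B i. \<exists>y\<in>B j. {x, y} \<in> E"
    using assms(1) by (rule has_complete_minorE) blast
  define idx where "idx x = (THE i. i < k \<and> x \<in> B i)" for x
  have idx: "idx x = i" if "i < k" "x \<in> B i" for i x
    unfolding idx_def using that disj by (intro the_equality) blast+
  have "{A. A \<subseteq> {..<k} \<and> card A = 2} \<subseteq> (\<lambda>e. idx ` e) ` E"
  proof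
    fix A assume "A \<in> {A. A \<subseteq> {..<k} \<and> card A = 2}"
    then obtain i j where A: "A = {i, j}" "i \<noteq> j" "i < k" "j < k" by (auto simp: card_2_iff)
    then obtain x y where xy: "x \<in> B i" "y \<in> B j" "{x, y} \<in> E" using edge by blast
    then have "idx ` {x, y} = A" using A idx by auto
    then show "A \<in> (\<lambda>e. idx ` e) ` E" using xy by blast
  qed
  then have "card {A. A \<subseteq> {..<k} \<and> card A = 2} \<le> card E"
    using assms(2) by (meson card_image_le card_mono finite_imageI order_trans)
  then show ?thesis by (simp add: n_subsets)
qed

text \<open>The connector of a pair is absorbed into the branch set of the smaller index and touches
  the segment of the larger one. Injectivity of \<open>\<phi>\<close> keeps the branch sets
  disjoint.\<close>

lemma has_complete_minor_of_connectors:
  fixes S :: "nat \<Rightarrow> nat set" and T :: "'q \<Rightarrow> nat set" and \<phi> :: "nat set \<Rightarrow> 'q"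
  assumes K: "finite K"
    and S: "disjoint_family_on S K" "\<And>i. i \<in> K \<Longrightarrow> S i \<subseteq> {..<n} \<and> connected_in E (S i)"
    and T: "disjoint_family_on T Q" "\<And>q. q \<in> Q \<Longrightarrow> T q \<subseteq> {..<n} \<and> connected_in E (T q)"
    and ST: "\<And>i q. i \<in> K \<Longrightarrow> q \<in> Q \<Longrightarrow> S i \<inter> T q = {}"
    and inj: "inj_on \<phi> {e. e \<subseteq> K \<and> card e = 2}"
    and \<phi>: "\<And>e. e \<subseteq> K \<Longrightarrow> card e = 2 \<Longrightarrow>
      \<phi> e \<in> Q \<and> (\<forall>i\<in>e. \<exists>x\<in>S i. \<exists>y\<in>T (\<phi> e). {x, y} \<in> E)"
  shows "has_complete_minor n E (card K)"
proof -
  obtain g where g: "bij_betw g {..<card K} K"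
    using ex_bij_betw_nat_finite[OF K] by (auto simp: atLeast0LessThan)
  have gK: "g i \<in> K" if "i < card K" for i using g that by (auto simp: bij_betw_def)
  have g_neq: "g i \<noteq> g j" if "i < card K" "j < card K" "i \<noteq> j" for i j
    using g that by (auto simp: bij_betw_def inj_on_def)
  define F where "F k = {e. e \<subseteq> K \<and> card e = 2 \<and> Min e = k}" for k
  define C where "C k = S k \<union> (\<Union>e\<in>F k. T (\<phi> e))" for k
  have finF: "finite (F k)" for k
    unfolding F_def using K by (rule finite_subset[rotated, OF finite_Pow_iff[THEN iffD2]]) auto
  have F: "\<phi> e \<in> Q" "\<exists>x\<in>S k. \<exists>y\<in>T (\<phi> e). {x, y} \<in> E" if "e \<in> F k" for e k
  proof -
    have e: "e \<subseteq> K" "card e = 2" "Min e = k" using that by (auto simp: F_def)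
    then have "k \<in> e" using Min_in[of e] by (metis card.infinite card.empty zero_neq_numeral)
    then show "\<phi> e \<in> Q" "\<exists>x\<in>S k. \<exists>y\<in>T (\<phi> e). {x, y} \<in> E" using \<phi>[OF e(1,2)] by auto
  qed
  have "C k \<subseteq> {..<n} \<and> connected_in E (C k)" if "k \<in> K" for k
    unfolding C_def using S(2)[OF that] T(2) F finF by (intro conjI connected_in_UN) blast+
  moreover have "C k \<inter> C l = {}" if "k \<in> K" "l \<in> K" "k \<noteq> l" for k l
  proof -
    have "S k \<inter> S l = {}" using S(1) that by (auto simp: disjoint_family_on_def)
    moreover have "S k \<inter> T (\<phi> e) = {}" if "e \<in> F l" for e using ST F(1) that \<open>k \<in> K\<close> by blast
    moreover have "S l \<inter> T (\<phi> e) = {}" if "e \<in> F k" for e using ST F(1) that \<open>l \<in> K\<close> by blast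
    moreover have "T (\<phi> e) \<inter> T (\<phi> e') = {}" if "e \<in> F k" "e' \<in> F l" for e e'
    proof -
      have "e \<noteq> e'" "e \<in> {e. e \<subseteq> K \<and> card e = 2}" "e' \<in> {e. e \<subseteq> K \<and> card e = 2}"
        using that \<open>k \<noteq> l\<close> by (auto simp: F_def)
      then have "\<phi> e \<noteq> \<phi> e'" using inj by (auto simp: inj_on_def)
      then show ?thesis using T(1) F(1) that unfolding disjoint_family_on_def by blast
    qed
    ultimately show ?thesis unfolding C_def by blast
  qed
  moreover have "\<exists>x\<in>C k. \<exists>y\<in>C l. {x, y} \<in> E" if kl: "k \<in> K" "l \<in> K" "k \<noteq> l" for k l
  proof -
    have less: "\<exists>x\<in>C k. \<exists>y\<in>C l. {x, y} \<in> E" if "k \<in> K" "l \<in> K" "k < l" for k l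
    proof -
      have e: "{k, l} \<subseteq> K" "card {k, l} = 2" using that by auto
      then obtain x y where xy: "x \<in> S l" "y \<in> T (\<phi> {k, l})" "{x, y} \<in> E" using \<phi> by blast
      have "{k, l} \<in> F k" using e that by (auto simp: F_def)
      then have "y \<in> C k" "x \<in> C l" using xy unfolding C_def by auto
      then show ?thesis using xy(3) by (metis insert_commute)
    qed
    show ?thesis
      using less[of k l] less[of l k] kl by (metis insert_commute linorder_neqE_nat)
  qed
  ultimately show ?thesis
    using gK g_neq by (intro has_complete_minorI[of _ "\<lambda>i. C (g i)"]) auto
qed

section \<open>Assigning connectors to pairs of segments\<close>

definition pairs_on :: "'a set \<Rightarrow> 'a set set" where
  "pairs_on V = {e. e \<subseteq> V \<and> card e = 2}"

lemma finite_pairs_on: "finite V \<Longrightarrow> finite (pairs_on V)"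
  unfolding pairs_on_def by (rule finite_subset[of _ "Pow V"]) auto

lemma card_pairs_on: "finite V \<Longrightarrow> card (pairs_on V) = card V choose 2"
  unfolding pairs_on_def by (rule n_subsets)

text \<open>\<open>\<tau> x i\<close> says that the connector \<open>x < 2 * M\<close> touches the \<open>i\<close>-th segment. At level \<open>s\<close> the
  connectors have to serve between \<open>4 ^ (s - 1)\<close> and \<open>4 ^ s\<close> pairs of segments.\<close>

definition connecting_level :: "nat \<Rightarrow> nat \<Rightarrow> nat \<Rightarrow> (nat \<Rightarrow> nat \<Rightarrow> bool) \<Rightarrow> bool" where
  "connecting_level k s M \<tau> \<longleftrightarrow>
     (\<forall>U \<subseteq> pairs_on {..<k}. 4 ^ s < 4 * card U \<and> card U \<le> 4 ^ s \<and>
        (\<forall>v<k. card {e\<in>U. v \<in> e} \<le> 8 * 2 ^ s) \<longrightarrow>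
        card {x\<in>{..<2 * M}. \<not> (\<exists>e\<in>U. \<forall>i\<in>e. \<tau> x i)} < M)"

lemma sum_degrees:
  assumes "finite V" "U \<subseteq> pairs_on V"
  shows "(\<Sum>v\<in>V. card {e\<in>U. v \<in> e}) = 2 * card U"
proof -
  have fin: "finite U" using assms finite_pairs_on finite_subset by blast
  have "(\<Sum>v\<in>V. card {e\<in>U. v \<in> e}) = (\<Sum>v\<in>V. \<Sum>e\<in>U. of_bool (v \<in> e))"
    using fin by (simp add: of_bool_def sum.If_cases Int_def)
  also have "\<dots> = (\<Sum>e\<in>U. \<Sum>v\<in>V. of_bool (v \<in> e))" by (rule sum.swap)
  also have "\<dots> = (\<Sum>e\<in>U. 2)"
  proof (intro sum.cong refl)
    fix e assume "e \<in> U"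
    then have e: "e \<subseteq> V" "card e = 2" using assms(2) by (auto simp: pairs_on_def)
    have "(\<Sum>v\<in>V. of_bool (v \<in> e)) = card (V \<inter> e)"
      using assms(1) by (simp add: of_bool_def sum.If_cases Int_def)
    also have "V \<inter> e = e" using e by blast
    finally show "(\<Sum>v\<in>V. of_bool (v \<in> e)) = (2::nat)" using e by simp
  qed
  finally show ?thesis by simp
qed

text \<open>Greedy assignment. While more than a quarter of \<open>4 ^ s\<close> pairs are unserved,
  the level property applies to the set \<open>U'\<close> of unserved pairs: fewer than
  \<open>M\<close> connectors serve none of them, and at most \<open>4 ^ s \<le> M\<close> are
  already in use. So one of the \<open>2 * M\<close> connectors is free and serves a pair of
  \<open>U'\<close>.\<close>

lemma connecting_level_matching:
  assumes level: "connecting_level k s M \<tau>" and M: "4 ^ s \<le> M"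
    and U: "U \<subseteq> pairs_on {..<k}" "card U \<le> 4 ^ s"
    and deg: "\<And>v. v < k \<Longrightarrow> card {e\<in>U. v \<in> e} \<le> 8 * 2 ^ s"
  shows "\<exists>U' \<psi>. U' \<subseteq> U \<and> 4 * card U' \<le> 4 ^ s \<and> inj_on \<psi> (U - U') \<and>
    (\<forall>e\<in>U - U'. \<psi> e < 2 * M \<and> (\<forall>i\<in>e. \<tau> (\<psi> e) i))"
proof -
  have fin: "finite U" using U(1) finite_pairs_on finite_subset by blast
  \<comment> \<open>The number \<open>m\<close> counts greedy rounds. For \<open>m = card U\<close>
    the second alternative means that \<open>U'\<close> is empty, so the first one holds in any
    case.\<close>
  have "\<exists>U' \<psi>. U' \<subseteq> U \<and> (4 * card U' \<le> 4 ^ s \<or> card U' + m \<le> card U) \<and> inj_on \<psi> (U - U') \<and>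
    (\<forall>e\<in>U - U'. \<psi> e < 2 * M \<and> (\<forall>i\<in>e. \<tau> (\<psi> e) i))" for m
  proof (induction m)
    case 0
    show ?case by (intro exI[of _ U]) auto
  next
    case (Suc m)
    then obtain U' \<psi> where U': "U' \<subseteq> U" "4 * card U' \<le> 4 ^ s \<or> card U' + m \<le> card U"
      and \<psi>: "inj_on \<psi> (U - U')" "\<And>e. e \<in> U - U' \<Longrightarrow> \<psi> e < 2 * M \<and> (\<forall>i\<in>e. \<tau> (\<psi> e) i)"
      by blast
    show ?case
    proof (cases "4 * card U' \<le> 4 ^ s")
      case True
      then show ?thesis using U' \<psi> by blast
    next
      case False
      then have few: "card U' + m \<le> card U" using U' by blast
      define X where "X = {x\<in>{..<2 * M}. \<not> (\<exists>e\<in>U'. \<forall>i\<in>e. \<tau> x i)}"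
      have finU': "finite U'" using U'(1) fin finite_subset by blast
      have "card U' \<le> card U" using U'(1) fin by (rule card_mono[rotated])
      moreover have "card {e\<in>U'. v \<in> e} \<le> 8 * 2 ^ s" if "v < k" for v
      proof -
        have "card {e\<in>U'. v \<in> e} \<le> card {e\<in>U. v \<in> e}" using U'(1) fin by (intro card_mono) auto
        then show ?thesis using deg[OF that] by linarith
      qed
      ultimately have X: "card X < M"
        using level U'(1) U False unfolding connecting_level_def X_def by (meson not_le order_trans)
      have "card (\<psi> ` (U - U')) \<le> card (U - U')" using fin by (intro card_image_le) auto
      also have "\<dots> \<le> card U" using fin by (intro card_mono) auto
      finally have "card (X \<union> \<psi> ` (U - U')) < 2 * M"
        using X M U(2) card_Un_le[of X "\<psi> ` (U - U')"] by linarith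
      then have "\<not> {..<2 * M} \<subseteq> X \<union> \<psi> ` (U - U')"
        using card_mono[of "X \<union> \<psi> ` (U - U')" "{..<2 * M}"] fin unfolding X_def by auto
      then obtain x where x: "x < 2 * M" "x \<notin> X" "x \<notin> \<psi> ` (U - U')" by auto
      then obtain e where e: "e \<in> U'" "\<forall>i\<in>e. \<tau> x i" unfolding X_def by auto
      let ?U' = "U' - {e}" and ?\<psi> = "\<psi>(e := x)"
      have diff: "U - ?U' = insert e (U - U')" using e U'(1) by blast
      have "e \<notin> U - U'" using e by blast
      then have "inj_on ?\<psi> (U - ?U')"
        unfolding diff using \<psi>(1) x(3) by (auto simp: inj_on_def)
      moreover have "\<forall>e'\<in>U - ?U'. ?\<psi> e' < 2 * M \<and> (\<forall>i\<in>e'. \<tau> (?\<psi> e') i)"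
        unfolding diff using \<psi>(2) x(1) e(2) by auto
      moreover have "card ?U' + Suc m \<le> card U"
      proof -
        have "card U' = Suc (card ?U')" using e(1) finU' by (metis card_Suc_Diff1)
        then show ?thesis using few by simp
      qed
      moreover have "?U' \<subseteq> U" using U'(1) by blast
      ultimately show ?thesis by (intro exI[of _ ?U'] exI[of _ ?\<psi>] conjI disjI2)
    qed
  qed
  then obtain U' \<psi> where U': "U' \<subseteq> U" "4 * card U' \<le> 4 ^ s \<or> card U' + card U \<le> card U"
      and \<psi>: "inj_on \<psi> (U - U')" "\<forall>e\<in>U - U'. \<psi> e < 2 * M \<and> (\<forall>i\<in>e. \<tau> (\<psi> e) i)"
    by blast
  then have "4 * card U' \<le> 4 ^ s" by auto
  then show ?thesis using U' \<psi> by blast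
qed

text \<open>Vertices of too large degree are discarded; the degree sum bounds their number.\<close>

lemma connecting_levels_assignment:
  assumes "\<And>s. s \<le> R \<Longrightarrow> connecting_level k s (M s) (\<tau> s)" "\<And>s. s \<le> R \<Longrightarrow> 4 ^ s \<le> M s"
    and "s \<le> R" "V \<subseteq> {..<k}" "U \<subseteq> pairs_on V" "card U \<le> 4 ^ s"
  shows "\<exists>V' \<phi>. V' \<subseteq> V \<and> 2 * card (V - V') \<le> 2 ^ s \<and> inj_on \<phi> (U \<inter> pairs_on V') \<and>
    (\<forall>e\<in>U \<inter> pairs_on V'. fst (\<phi> e) \<le> s \<and> snd (\<phi> e) < 2 * M (fst (\<phi> e)) \<and>
      (\<forall>i\<in>e. \<tau> (fst (\<phi> e)) (snd (\<phi> e)) i))"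
  using assms(3-)
proof (induction s arbitrary: V U)
  have main: "\<exists>V1 U' \<psi>. V1 \<subseteq> V \<and> 4 * card (V - V1) \<le> 2 ^ s \<and> U' \<subseteq> U \<inter> pairs_on V1 \<and>
      4 * card U' \<le> 4 ^ s \<and> inj_on \<psi> (U \<inter> pairs_on V1 - U') \<and>
      (\<forall>e\<in>U \<inter> pairs_on V1 - U'. \<psi> e < 2 * M s \<and> (\<forall>i\<in>e. \<tau> s (\<psi> e) i))"
    if s: "s \<le> R" and V: "V \<subseteq> {..<k}" and U: "U \<subseteq> pairs_on V" "card U \<le> 4 ^ s" for s V U
  proof -
    have finV: "finite V" using V finite_subset by blast
    have finU: "finite U" using U(1) finV finite_pairs_on finite_subset by blast
    \<comment> \<open>The degree sum is at most \<open>2 * 4 ^ s\<close> and a discarded vertex has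
      degree above \<open>8 * 2 ^ s\<close>, so at most a quarter of \<open>2 ^ s\<close> vertices
      are lost.\<close>
    define V1 where "V1 = {v\<in>V. card {e\<in>U. v \<in> e} \<le> 8 * 2 ^ s}"
    have "card (V - V1) * (8 * 2 ^ s) = (\<Sum>v\<in>V - V1. 8 * 2 ^ s)" by simp
    also have "\<dots> \<le> (\<Sum>v\<in>V - V1. card {e\<in>U. v \<in> e})"
      by (intro sum_mono) (auto simp: V1_def)
    also have "\<dots> \<le> (\<Sum>v\<in>V. card {e\<in>U. v \<in> e})" using finV by (intro sum_mono2) auto
    also have "\<dots> = 2 * card U" by (rule sum_degrees[OF finV U(1)])
    also have "\<dots> \<le> 2 * (2 ^ s * 2 ^ s)" using U(2) by (simp flip: power_mult_distrib)
    finally have "(4 * card (V - V1)) * (2 * 2 ^ s) \<le> 2 ^ s * (2 * 2 ^ s)" by (simp add: mult_ac)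
    then have del: "4 * card (V - V1) \<le> 2 ^ s" by (simp only: mult_le_cancel2) simp
    let ?U = "U \<inter> pairs_on V1"
    have "card ?U \<le> card U" using finU by (intro card_mono) auto
    then have U1: "?U \<subseteq> pairs_on {..<k}" "card ?U \<le> 4 ^ s"
      using U V by (auto simp: pairs_on_def)
    have deg: "card {e\<in>?U. v \<in> e} \<le> 8 * 2 ^ s" for v
    proof (cases "v \<in> V1")
      case True
      have "card {e\<in>?U. v \<in> e} \<le> card {e\<in>U. v \<in> e}" using finU by (intro card_mono) auto
      then show ?thesis using True by (simp add: V1_def)
    next
      case False
      then have "{e\<in>?U. v \<in> e} = {}" by (auto simp: pairs_on_def)
      then show ?thesis by (simp only: card.empty)
    qed
    show ?thesis
      using connecting_level_matching[OF assms(1)[OF s] assms(2)[OF s] U1 deg] del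
      by (intro exI[of _ V1]) (auto simp: V1_def)
  qed
  {
    case 0
    obtain V1 U' \<psi> where V1: "V1 \<subseteq> V" "4 * card (V - V1) \<le> 2 ^ 0" and U': "U' \<subseteq> U \<inter> pairs_on V1"
      "4 * card U' \<le> 4 ^ 0" and \<psi>: "inj_on \<psi> (U \<inter> pairs_on V1 - U')"
      "\<And>e. e \<in> U \<inter> pairs_on V1 - U' \<Longrightarrow> \<psi> e < 2 * M 0 \<and> (\<forall>i\<in>e. \<tau> 0 (\<psi> e) i)"
      using main[OF 0] by blast
    have "finite V" using 0(2) finite_subset by blast
    then have "finite U'"
      using U'(1) 0(3) finite_pairs_on finite_subset by (meson le_inf_iff)
    \<comment> \<open>At level 0 the bound \<open>4 * card U' \<le> 1\<close> leaves no pair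
      unserved, so the descent through the levels ends here.\<close>
    moreover have "card U' = 0" using U'(2) by (cases "card U'") auto
    ultimately have "U' = {}" by simp
    then show ?case using V1 \<psi>
      by (intro exI[of _ V1] exI[of _ "\<lambda>e. (0, \<psi> e)"]) (auto simp: inj_on_def)
  next
    case (Suc s)
    obtain V1 U' \<psi> where V1: "V1 \<subseteq> V" "4 * card (V - V1) \<le> 2 ^ Suc s" and U': "U' \<subseteq> U \<inter> pairs_on V1"
      "4 * card U' \<le> 4 ^ Suc s" and \<psi>: "inj_on \<psi> (U \<inter> pairs_on V1 - U')"
      "\<And>e. e \<in> U \<inter> pairs_on V1 - U' \<Longrightarrow> \<psi> e < 2 * M (Suc s) \<and> (\<forall>i\<in>e. \<tau> (Suc s) (\<psi> e) i)"
      using main[OF Suc.prems] by blast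
    have finV: "finite V" using Suc.prems(2) finite_subset by blast
    obtain V' \<phi> where V': "V' \<subseteq> V1" "2 * card (V1 - V') \<le> 2 ^ s" and \<phi>: "inj_on \<phi> (U' \<inter> pairs_on V')"
      "\<And>e. e \<in> U' \<inter> pairs_on V' \<Longrightarrow> fst (\<phi> e) \<le> s \<and> snd (\<phi> e) < 2 * M (fst (\<phi> e)) \<and>
        (\<forall>i\<in>e. \<tau> (fst (\<phi> e)) (snd (\<phi> e)) i)"
      using Suc.IH[of V1 U'] Suc.prems(1) subset_trans[OF V1(1) Suc.prems(2)] U' by auto
    \<comment> \<open>The first component records the level, so pairs served at different levels
      receive different connectors.\<close>
    define \<xi> where "\<xi> e = (if e \<in> U' then \<phi> e else (Suc s, \<psi> e))" for e
    have sub: "pairs_on V' \<subseteq> pairs_on V1" using V'(1) by (auto simp: pairs_on_def)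
    have "card (V - V') \<le> card (V - V1) + card (V1 - V')"
    proof -
      have "V - V' \<subseteq> (V - V1) \<union> (V1 - V')" by blast
      then have "card (V - V') \<le> card ((V - V1) \<union> (V1 - V'))"
        using finV V1(1) finite_subset[OF V1(1) finV] by (intro card_mono) auto
      then show ?thesis using card_Un_le[of "V - V1" "V1 - V'"] by linarith
    qed
    \<comment> \<open>This level discards at most a quarter of \<open>2 ^ Suc s\<close> vertices and
      the lower levels at most half of \<open>2 ^ s\<close>; together this is half of
      \<open>2 ^ Suc s\<close>.\<close>
    then have "2 * card (V - V') \<le> 2 ^ Suc s" using V1(2) V'(2) by simp
    moreover have "inj_on \<xi> (U \<inter> pairs_on V')"
    proof (rule inj_onI)
      fix e e' assume e: "e \<in> U \<inter> pairs_on V'" "e' \<in> U \<inter> pairs_on V'" "\<xi> e = \<xi> e'"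
      have "fst (\<phi> e) \<noteq> Suc s" if "e \<in> U'" "e \<in> pairs_on V'" for e using \<phi>(2)[of e] that by auto
      then consider "e \<in> U'" "e' \<in> U'" | "e \<notin> U'" "e' \<notin> U'"
        using e unfolding \<xi>_def by (metis IntE fst_conv)
      then show "e = e'"
      proof cases
        case 1
        then show ?thesis using e \<phi>(1) unfolding \<xi>_def by (auto simp: inj_on_def)
      next
        case 2
        then show ?thesis using e \<psi>(1) sub unfolding \<xi>_def by (auto simp: inj_on_def)
      qed
    qed
    moreover have "fst (\<xi> e) \<le> Suc s \<and> snd (\<xi> e) < 2 * M (fst (\<xi> e)) \<and>
        (\<forall>i\<in>e. \<tau> (fst (\<xi> e)) (snd (\<xi> e)) i)" if "e \<in> U \<inter> pairs_on V'" for e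
    proof (cases "e \<in> U'")
      case True
      then show ?thesis using \<phi>(2)[of e] that by (simp add: \<xi>_def)
    next
      case False
      then show ?thesis using \<psi>(2)[of e] that sub by (auto simp: \<xi>_def)
    qed
    ultimately show ?case using V1(1) V'(1) by (intro exI[of _ V'] exI[of _ \<xi>]) auto
  }
qed

text \<open>The descent starts at level \<open>R\<close> with all pairs of the \<open>2 ^ R\<close>
  segments, which are fewer than \<open>4 ^ R\<close>; the discarded segments over all levels amount
  to at most half.\<close>

lemma connecting_levels_complete:
  assumes "\<And>s. s \<le> R \<Longrightarrow> connecting_level (2 ^ R) s (M s) (\<tau> s)" "\<And>s. s \<le> R \<Longrightarrow> 4 ^ s \<le> M s"
  shows "\<exists>K \<phi>. K \<subseteq> {..<2 ^ R} \<and> 2 ^ R \<le> 2 * card K \<and> inj_on \<phi> (pairs_on K) \<and>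
    (\<forall>e\<in>pairs_on K. fst (\<phi> e) \<le> R \<and> snd (\<phi> e) < 2 * M (fst (\<phi> e)) \<and>
      (\<forall>i\<in>e. \<tau> (fst (\<phi> e)) (snd (\<phi> e)) i))"
proof -
  have "(2 ^ R :: nat) choose 2 \<le> 2 ^ R * 2 ^ R"
    by (simp add: choose_two div_le_dividend order_trans[OF div_le_dividend])
  also have "\<dots> = (4::nat) ^ R" by (simp flip: power_mult_distrib)
  finally have "card (pairs_on {..<2 ^ R :: nat}) \<le> 4 ^ R" by (simp add: card_pairs_on)
  then obtain K \<phi> where K: "K \<subseteq> {..<2 ^ R}" "2 * card ({..<2 ^ R} - K) \<le> 2 ^ R"
    "inj_on \<phi> (pairs_on {..<2 ^ R} \<inter> pairs_on K)"
    "\<forall>e\<in>pairs_on {..<2 ^ R} \<inter> pairs_on K. fst (\<phi> e) \<le> R \<and> snd (\<phi> e) < 2 * M (fst (\<phi> e)) \<and>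
      (\<forall>i\<in>e. \<tau> (fst (\<phi> e)) (snd (\<phi> e)) i)"
    using connecting_levels_assignment[of R "2 ^ R" M \<tau> R "{..<2 ^ R}" "pairs_on {..<2 ^ R}", OF assms]
    by auto
  have "pairs_on {..<2 ^ R} \<inter> pairs_on K = pairs_on K" using K(1) by (auto simp: pairs_on_def)
  moreover have "card ({..<2 ^ R} - K) = 2 ^ R - card K"
    using K(1) by (simp add: card_Diff_subset finite_subset)
  ultimately show ?thesis using K by (intro exI[of _ K] exI[of _ \<phi>]) auto
qed

section \<open>Long paths in sparse random graphs\<close>

lemma rs_prob_union_bound:
  assumes "0 \<le> p" "p \<le> 1" "finite I" "\<And>E. E \<subseteq> V \<Longrightarrow> Q E \<Longrightarrow> \<exists>i\<in>I. P i E"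
  shows "rs_prob V p Q \<le> (\<Sum>i\<in>I. rs_prob V p (P i))"
proof -
  have "rs_prob V p Q \<le> rs_expect V p (\<lambda>E. \<Sum>i\<in>I. of_bool (P i E))"
  proof (intro rs_expect_mono assms(1,2))
    fix E assume E: "E \<subseteq> V"
    have nonneg: "0 \<le> (\<Sum>i\<in>I. of_bool (P i E) :: real)" by (intro sum_nonneg) auto
    show "of_bool (Q E) \<le> (\<Sum>i\<in>I. of_bool (P i E) :: real)"
    proof (cases "Q E")
      case True
      then obtain i where i: "i \<in> I" "P i E" using assms(4) E by blast
      then show ?thesis using member_le_sum[OF i(1) _ assms(3), of "\<lambda>i. of_bool (P i E) :: real"] by simp
    qed (use nonneg in simp)
  qed
  then show ?thesis by (simp add: rs_expect_sum)
qed

lemma finite_vertex_pairs: "finite (vertex_pairs n)"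
  unfolding vertex_pairs_def by (rule finite_subset[of _ "Pow {..<n}"]) auto

lemma card_vertex_pairs: "card (vertex_pairs n) = n choose 2"
  unfolding vertex_pairs_def by (simp add: n_subsets)

definition is_path :: "nat \<Rightarrow> nat set set \<Rightarrow> nat list \<Rightarrow> bool" where
  "is_path n E xs \<longleftrightarrow> distinct xs \<and> set xs \<subseteq> {..<n} \<and> successively (\<lambda>x y. {x, y} \<in> E) xs"

text \<open>A union bound over all states of depth-first search with \<open>s\<close> visited vertices and at most \<open>t\<close>
  vertices on the stack: the parent edges are present, while all edges between finished and unvisited
  vertices are absent.\<close>

lemma rs_prob_no_path_le:
  fixes p y z :: real
  assumes s: "s \<le> n" and p: "0 \<le> p" "p \<le> 1" and y: "0 < y" "y \<le> 1" and z: "0 < z" "z \<le> 1"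
  shows "rs_prob (vertex_pairs n) p (\<lambda>E. \<not> (\<exists>xs. is_path n E xs \<and> t < length xs))
    \<le> real (n + 1) * ((1 / z) ^ s * (1 + real s * p * z) ^ n * ((1 / y) ^ t * (1 + y) ^ s) *
      (1 - p) ^ ((s - t) * (n - s)))"
proof -
  \<comment> \<open>A configuration consists of the threshold \<open>b\<close>, the set
    \<open>W\<close> of non-roots, the parent map \<open>f\<close> and the vertex set
    \<open>U\<close> of the stack. The roots need no choice of their own: they are the vertices
    below \<open>b\<close> outside \<open>W\<close>.\<close>
  define X where "X b W = W \<union> {..<b}" for b :: nat and W
  define \<W> where "\<W> b = {W. W \<subseteq> {..<n} \<and> card W \<le> s \<and> card (X b W) = s}" for b
  \<comment> \<open>Extensional functions keep the number of parent maps finite; the parent map of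
    an actual search is therefore restricted to \<open>W\<close> below.\<close>
  define \<F> where "\<F> b W = {f \<in> W \<rightarrow>\<^sub>E X b W. inj_on (\<lambda>v. {v, f v}) W \<and> (\<forall>v\<in>W. f v \<noteq> v)}" for b W
  define \<U> where "\<U> b W = {U. U \<subseteq> X b W \<and> card U \<le> t}" for b W
  define I where "I = (SIGMA b:{..n}. SIGMA W:\<W> b. \<F> b W \<times> \<U> b W)"
  define A where "A W f = (\<lambda>v. {v, f v}) ` W" for W :: "nat set" and f :: "nat \<Rightarrow> nat"
  define B where "B b W U = (\<lambda>(x, y). {x, y}) ` ((X b W - U) \<times> ({..<n} - X b W))" for b W U
  define P where "P = (\<lambda>(b, W, f, U) E. A W f \<subseteq> E \<and> E \<inter> B b W U = {})"
  define Q where "Q = (1 - p) ^ ((s - t) * (n - s))"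
  have Q: "0 \<le> Q" using p by (simp add: Q_def)
  have finX: "finite (X b W)" "X b W \<subseteq> {..<n}" "finite W" if "b \<le> n" "W \<in> \<W> b" for b W
    using that by (auto simp: X_def \<W>_def intro: finite_subset)
  have fin\<W>: "finite (\<W> b)" for b
    unfolding \<W>_def by (rule finite_subset[of _ "Pow {..<n}"]) auto
  have fin\<F>: "finite (\<F> b W)" and card\<F>: "card (\<F> b W) \<le> s ^ card W" if "b \<le> n" "W \<in> \<W> b" for b W
  proof -
    have fin: "finite (W \<rightarrow>\<^sub>E X b W)" using finX[OF that] by (intro finite_PiE) auto
    show "finite (\<F> b W)" unfolding \<F>_def using fin by simp
    have "card (\<F> b W) \<le> card (W \<rightarrow>\<^sub>E X b W)" unfolding \<F>_def using fin by (intro card_mono) auto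
    also have "\<dots> = s ^ card W" using finX[OF that] that by (simp add: card_PiE \<W>_def)
    finally show "card (\<F> b W) \<le> s ^ card W" .
  qed
  have fin\<U>: "finite (\<U> b W)" if "b \<le> n" "W \<in> \<W> b" for b W
    unfolding \<U>_def by (rule finite_subset[of _ "Pow (X b W)"]) (use finX[OF that] in auto)
  have card\<U>: "real (card (\<U> b W)) \<le> (1 / y) ^ t * (1 + y) ^ s" if "b \<le> n" "W \<in> \<W> b" for b W
    using card_small_subsets_le[OF finX(1)[OF that] y, of t] that unfolding \<U>_def \<W>_def by auto
  have finI: "finite I"
    unfolding I_def using fin\<W> fin\<F> fin\<U> by (intro finite_SigmaI finite_cartesian_product) auto
  have "rs_prob (vertex_pairs n) p (\<lambda>E. \<not> (\<exists>xs. is_path n E xs \<and> t < length xs))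
      \<le> (\<Sum>i\<in>I. rs_prob (vertex_pairs n) p (P i))"
  proof (rule rs_prob_union_bound[OF p finI])
    fix E assume E: "\<not> (\<exists>xs. is_path n E xs \<and> t < length xs)"
    obtain b W f us where st: "dfs_state n E b W f us" and X: "card (X b W) = s"
      using dfs_state_exists[OF s, of E] unfolding X_def by blast
    note st' = st[unfolded dfs_state_def, folded X_def]
    have "is_path n E us" unfolding is_path_def using st' finX(2) by (auto simp: X_def)
    then have len: "length us \<le> t" using E by auto
    have b: "b \<le> n" using st' by simp
    have "finite (X b W)" using st' by (auto simp: X_def intro: finite_subset)
    then have "card W \<le> card (X b W)" by (intro card_mono) (auto simp: X_def)
    then have W: "W \<in> \<W> b" using st' X by (simp add: \<W>_def)
    have "inj_on (\<lambda>v. {v, restrict f W v}) W = inj_on (\<lambda>v. {v, f v}) W"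
      by (intro inj_on_cong) simp
    then have "restrict f W \<in> \<F> b W"
      using st' by (auto simp: \<F>_def)
    moreover have "set us \<in> \<U> b W"
      using st' len by (simp add: \<U>_def distinct_card)
    ultimately have "(b, W, restrict f W, set us) \<in> I"
      using b W by (simp add: I_def)
    moreover have "P (b, W, restrict f W, set us) E"
    proof -
      have "A W (restrict f W) \<subseteq> E" using st' by (auto simp: A_def)
      moreover have "E \<inter> B b W (set us) = {}" using st' by (auto simp: B_def)
      ultimately show ?thesis by (simp add: P_def)
    qed
    ultimately show "\<exists>i\<in>I. P i E" by blast
  qed
  also have "\<dots> \<le> (\<Sum>i\<in>I. case i of (b, W, f, U) \<Rightarrow> p ^ card W * Q)"
  proof (intro sum_mono)
    fix i assume "i \<in> I"
    then obtain b W f U where i: "i = (b, W, f, U)" and b: "b \<le> n" and W: "W \<in> \<W> b"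
      and f: "f \<in> \<F> b W" and U: "U \<in> \<U> b W"
      unfolding I_def by auto
    note X = finX[OF b W]
    have cX: "card (X b W) = s" using W by (simp add: \<W>_def)
    have fv: "f v \<in> X b W" "f v \<noteq> v" "v \<in> X b W" if "v \<in> W" for v
      using f that by (auto simp: \<F>_def X_def)
    have A: "A W f \<subseteq> vertex_pairs n" "card (A W f) = card W"
    proof -
      show "A W f \<subseteq> vertex_pairs n" using fv X(2) by (auto simp: A_def vertex_pairs_def card_2_iff)
      show "card (A W f) = card W" unfolding A_def using f by (intro card_image) (simp add: \<F>_def)
    qed
    have inj: "inj_on (\<lambda>(x, y). {x, y}) ((X b W - U) \<times> ({..<n} - X b W))"
      by (auto simp: inj_on_def doubleton_eq_iff)
    have "card (B b W U) = card (X b W - U) * card ({..<n} - X b W)"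
      unfolding B_def by (simp add: card_image[OF inj] card_cartesian_product)
    also have "card ({..<n} - X b W) = n - s" using X cX by (simp add: card_Diff_subset)
    finally have cB: "card (B b W U) = card (X b W - U) * (n - s)" .
    have "U \<subseteq> X b W" "card U \<le> t" using U by (auto simp: \<U>_def)
    then have "s - t \<le> card (X b W - U)" using X cX finite_subset[OF _ X(1)] by (simp add: card_Diff_subset)
    then have B: "(s - t) * (n - s) \<le> card (B b W U)" unfolding cB by (rule mult_le_mono1)
    have Bsub: "B b W U \<subseteq> vertex_pairs n"
      using X(2) by (force simp: B_def vertex_pairs_def card_2_iff)
    \<comment> \<open>Parent edges lie inside the visited set and the forbidden edges leave it, so
      the two requirements are independent and their probabilities multiply.\<close>
    have AB: "A W f \<inter> B b W U = {}"
    proof -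
      have "e \<subseteq> X b W" if "e \<in> A W f" for e using that fv by (auto simp: A_def)
      moreover have "\<not> e \<subseteq> X b W" if "e \<in> B b W U" for e using that by (auto simp: B_def)
      ultimately show ?thesis by blast
    qed
    have "rs_prob (vertex_pairs n) p (P i) = p ^ card W * (1 - p) ^ card (B b W U)"
      using rs_prob_contains_avoids[OF finite_vertex_pairs A(1) Bsub AB, of p] A(2) by (simp add: P_def i)
    also have "\<dots> \<le> p ^ card W * Q"
      unfolding Q_def using p B by (intro mult_left_mono power_decreasing) auto
    finally show "rs_prob (vertex_pairs n) p (P i) \<le> (case i of (b, W, f, U) \<Rightarrow> p ^ card W * Q)"
      by (simp add: i)
  qed
  also have "\<dots> = (\<Sum>b\<le>n. \<Sum>W\<in>\<W> b. \<Sum>fU\<in>\<F> b W \<times> \<U> b W. p ^ card W * Q)"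
  proof -
    have "(\<Sum>W\<in>\<W> b. \<Sum>fU\<in>\<F> b W \<times> \<U> b W. p ^ card W * Q)
        = (\<Sum>(W, f, U)\<in>(SIGMA W:\<W> b. \<F> b W \<times> \<U> b W). p ^ card W * Q)" if "b \<le> n" for b
      using that fin\<W> fin\<F> fin\<U>
      by (subst sum.Sigma) (auto simp: case_prod_unfold intro!: finite_cartesian_product)
    moreover have "(\<Sum>b\<le>n. \<Sum>(W, f, U)\<in>(SIGMA W:\<W> b. \<F> b W \<times> \<U> b W). p ^ card W * Q)
        = (\<Sum>i\<in>I. case i of (b, W, f, U) \<Rightarrow> p ^ card W * Q)"
      unfolding I_def using fin\<W> fin\<F> fin\<U>
      by (subst sum.Sigma) (auto simp: case_prod_unfold intro!: finite_SigmaI finite_cartesian_product)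
    ultimately show ?thesis by simp
  qed
  \<comment> \<open>Each non-root has at most \<open>s\<close> possible parents, and its parent edge
    costs a factor \<open>p\<close>. The resulting weights are then summed over \<open>W\<close>
    with \<open>sum_power_card_le\<close>.\<close>
  also have "\<dots> \<le> (\<Sum>b\<le>n. \<Sum>W\<in>\<W> b. (real s * p) ^ card W * ((1 / y) ^ t * (1 + y) ^ s * Q))"
  proof (intro sum_mono)
    fix b W assume "b \<in> {..n}" and W: "W \<in> \<W> b"
    then have b: "b \<le> n" by simp
    have "real (card (\<F> b W)) \<le> real s ^ card W"
      using card\<F>[OF b W] by (metis of_nat_le_iff of_nat_power)
    then have "real (card (\<F> b W \<times> \<U> b W)) \<le> real s ^ card W * ((1 / y) ^ t * (1 + y) ^ s)"
      using card\<U>[OF b W] unfolding card_cartesian_product of_nat_mult by (intro mult_mono) auto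
    then have "real (card (\<F> b W \<times> \<U> b W)) * (p ^ card W * Q)
        \<le> real s ^ card W * ((1 / y) ^ t * (1 + y) ^ s) * (p ^ card W * Q)"
      using p Q by (intro mult_right_mono) auto
    then show "(\<Sum>fU\<in>\<F> b W \<times> \<U> b W. p ^ card W * Q)
        \<le> (real s * p) ^ card W * ((1 / y) ^ t * (1 + y) ^ s * Q)"
      by (simp add: power_mult_distrib mult_ac)
  qed
  also have "\<dots> \<le> (\<Sum>b\<le>n. (1 / z) ^ s * (1 + real s * p * z) ^ n * ((1 / y) ^ t * (1 + y) ^ s * Q))"
  proof (intro sum_mono)
    fix b
    have "(\<Sum>W\<in>\<W> b. (real s * p) ^ card W)
        \<le> (\<Sum>W\<in>{W. W \<subseteq> {..<n} \<and> card W \<le> s}. (real s * p) ^ card W)"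
      using p by (intro sum_mono2) (auto simp: \<W>_def intro: finite_subset[of _ "Pow {..<n}"])
    also have "\<dots> \<le> (1 / z) ^ s * (1 + real s * p * z) ^ card {..<n}"
      using p z by (intro sum_power_card_le) auto
    finally show "(\<Sum>W\<in>\<W> b. (real s * p) ^ card W * ((1 / y) ^ t * (1 + y) ^ s * Q))
        \<le> (1 / z) ^ s * (1 + real s * p * z) ^ n * ((1 / y) ^ t * (1 + y) ^ s * Q)"
      unfolding sum_distrib_right[symmetric] using y Q by (intro mult_right_mono) auto
  qed
  finally show ?thesis
    by (simp add: Q_def mult.assoc)
qed

text \<open>The search is stopped at about \<open>\<sigma> * n\<close> visited vertices with stack
  bound \<open>t\<close> about \<open>\<tau> * s\<close>. The main term of the union bound is
  \<open>exp (- \<kappa> * s)\<close>, where \<open>exp (- \<kappa>) = c * exp (1 - c) < 1\<close>.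
  Three corrections remain: the factor \<open>1 + y\<close> from counting stacks, the visited
  vertices missing among the \<open>n - s\<close> endpoints, and the unfinished vertices together
  with the factor \<open>1 / y\<close>. The choices of \<open>y\<close>, \<open>\<sigma>\<close> and
  \<open>\<tau>\<close> limit each to \<open>\<kappa> * s / 8\<close> in the exponent.\<close>

lemma rs_prob_no_long_path_tendsto:
  fixes c :: real
  assumes c: "c > 1"
  shows "\<exists>\<theta>>0. (\<lambda>n. rs_prob (vertex_pairs n) (c / real n)
    (\<lambda>E. \<not> (\<exists>xs. is_path n E xs \<and> \<theta> * real n \<le> real (length xs)))) \<longlonglongrightarrow> 0"
proof -
  define \<kappa> where "\<kappa> = c - 1 - ln c"
  have \<kappa>: "\<kappa> > 0" using ln_add_one_self_less_self[of "c - 1"] c by (simp add: \<kappa>_def)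
  define y where "y = min 1 (\<kappa> / 8)"
  have y: "0 < y" "y \<le> 1" "y \<le> \<kappa> / 8" using \<kappa> by (auto simp: y_def)
  define \<sigma> where "\<sigma> = min 1 (\<kappa> / (8 * c))"
  have \<sigma>: "0 < \<sigma>" "\<sigma> \<le> 1" "c * \<sigma> \<le> \<kappa> / 8"
    using \<kappa> c by (auto simp: \<sigma>_def min_def field_simps)
  define \<tau> where "\<tau> = min 1 (\<kappa> / (8 * (c + ln (1 / y))))"
  have ly: "0 \<le> ln (1 / y)" using y by simp
  have \<tau>: "0 < \<tau>" "\<tau> \<le> 1" "\<tau> * (c + ln (1 / y)) \<le> \<kappa> / 8"
  proof -
    have pos: "0 < c + ln (1 / y)" using c ly by linarith
    show "0 < \<tau>" "\<tau> \<le> 1" unfolding \<tau>_def using \<kappa> pos by simp_all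
    have "\<tau> \<le> \<kappa> / (8 * (c + ln (1 / y)))" by (simp add: \<tau>_def)
    then have "\<tau> * (8 * (c + ln (1 / y))) \<le> \<kappa>"
      using pos by (subst (asm) pos_le_divide_eq) auto
    then show "\<tau> * (c + ln (1 / y)) \<le> \<kappa> / 8" by (simp add: algebra_simps)
  qed
  define \<theta> where "\<theta> = \<tau> * \<sigma> / 2"
  define x where "x = exp (- (\<kappa> * \<sigma> / 2))"
  have x: "0 < x" "x < 1" using \<kappa> \<sigma> by (auto simp: x_def)
  let ?pr = "\<lambda>n. rs_prob (vertex_pairs n) (c / real n)
    (\<lambda>E. \<not> (\<exists>xs. is_path n E xs \<and> \<theta> * real n \<le> real (length xs)))"
  have bound: "?pr n \<le> real (n + 1) * (exp (\<kappa> / 2) * x ^ n)" if n: "real n \<ge> c" "real n \<ge> 2 / \<sigma>" for n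
  proof -
    have n0: "0 < real n" using n c by linarith
    define s where "s = nat \<lfloor>\<sigma> * real n\<rfloor>"
    define t where "t = nat \<lfloor>\<tau> * real s\<rfloor>"
    define p where "p = c / real n"
    have p: "0 \<le> p" "p \<le> 1" using n n0 c by (auto simp: p_def)
    have s: "real s \<le> \<sigma> * real n" "\<sigma> * real n - 1 < real s"
    proof -
      have "0 \<le> \<sigma> * real n" using \<sigma> by simp
      then have "real s = of_int \<lfloor>\<sigma> * real n\<rfloor>" by (simp add: s_def)
      then show "real s \<le> \<sigma> * real n" "\<sigma> * real n - 1 < real s" by linarith+
    qed
    have t: "real t \<le> \<tau> * real s" "\<tau> * real s < real t + 1"
    proof -
      have "0 \<le> \<tau> * real s" using \<tau> by simp
      then have "real t = of_int \<lfloor>\<tau> * real s\<rfloor>" by (simp add: t_def)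
      then show "real t \<le> \<tau> * real s" "\<tau> * real s < real t + 1" by linarith+
    qed
    have sn: "s \<le> n"
    proof -
      have "\<sigma> * real n \<le> 1 * real n" using \<sigma> by (intro mult_right_mono) auto
      then show ?thesis using s by linarith
    qed
    have ts: "t \<le> s"
    proof -
      have "\<tau> * real s \<le> 1 * real s" using \<tau> by (intro mult_right_mono) auto
      then show ?thesis using t by linarith
    qed
    have "?pr n \<le> rs_prob (vertex_pairs n) p (\<lambda>E. \<not> (\<exists>xs. is_path n E xs \<and> t < length xs))"
      unfolding p_def[symmetric]
    proof (intro rs_expect_mono p)
      fix E
      \<comment> \<open>For \<open>n \<ge> 2 / \<sigma>\<close> rounding down at most halves
        \<open>\<sigma> * n\<close>, whence the factor 1/2 in \<open>\<theta>\<close>; rounding in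
        \<open>t\<close> is made up for by the strict inequality \<open>t < l\<close>.\<close>
      have "\<theta> * real n \<le> real l" if "t < l" for l
      proof -
        have "2 \<le> \<sigma> * real n" using n \<sigma> by (simp add: field_simps)
        then have "\<sigma> * real n / 2 \<le> real s" using s by linarith
        then have "\<tau> * (\<sigma> * real n / 2) \<le> \<tau> * real s" using \<tau> by (intro mult_left_mono) auto
        then show ?thesis using t that unfolding \<theta>_def by simp
      qed
      then show "of_bool (\<not> (\<exists>xs. is_path n E xs \<and> \<theta> * real n \<le> real (length xs)))
          \<le> (of_bool (\<not> (\<exists>xs. is_path n E xs \<and> t < length xs)) :: real)"
        by auto
    qed
    \<comment> \<open>The weight \<open>z = 1 / c\<close> gives \<open>s * p * z = s / n\<close>, so
      the sum over forests contributes at most \<open>(c * exp 1) ^ s\<close>.\<close>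
    also have "\<dots> \<le> real (n + 1) * ((1 / (1 / c)) ^ s * (1 + real s * p * (1 / c)) ^ n *
        ((1 / y) ^ t * (1 + y) ^ s) * (1 - p) ^ ((s - t) * (n - s)))"
      using c by (intro rs_prob_no_path_le sn p y) auto
    also have "\<dots> \<le> real (n + 1) * (exp (real s * ln c) * exp (real s) *
        (exp (real t * ln (1 / y)) * exp (real s * y)) * exp (- (c * (real s - real t) * (1 - \<sigma>))))"
    proof (intro mult_left_mono mult_mono)
      show "(1 / (1 / c)) ^ s \<le> exp (real s * ln c)"
        using c by (simp add: exp_of_nat_mult)
      have "(1 + real s * p * (1 / c)) ^ n \<le> exp (real s * p * (1 / c)) ^ n"
        using p c by (intro power_mono) (auto intro!: add_nonneg_nonneg)
      also have "\<dots> = exp (real s)" using n0 c by (simp add: p_def flip: exp_of_nat_mult)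
      finally show "(1 + real s * p * (1 / c)) ^ n \<le> exp (real s)" .
      show "(1 / y) ^ t \<le> exp (real t * ln (1 / y))"
        unfolding exp_of_nat_mult using y by simp
      show "(1 + y) ^ s \<le> exp (real s * y)"
        unfolding exp_of_nat_mult using y by (intro power_mono) auto
      have "(1 - p) ^ ((s - t) * (n - s)) \<le> exp (- p) ^ ((s - t) * (n - s))"
        using p exp_ge_add_one_self[of "- p"] by (intro power_mono) auto
      also have "\<dots> = exp (- (p * ((real s - real t) * (real n - real s))))"
        using sn ts by (simp add: of_nat_diff flip: exp_of_nat_mult)
      also have "\<dots> \<le> exp (- (c * (real s - real t) * (1 - \<sigma>)))"
      proof -
        have "c * (real s - real t) * (1 - \<sigma>) = p * ((real s - real t) * (real n - \<sigma> * real n))"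
          using n0 by (simp add: p_def field_simps)
        also have "\<dots> \<le> p * ((real s - real t) * (real n - real s))"
          using s ts p by (intro mult_left_mono) auto
        finally show ?thesis by simp
      qed
      finally show "(1 - p) ^ ((s - t) * (n - s)) \<le> exp (- (c * (real s - real t) * (1 - \<sigma>)))" .
    qed (use c y p in \<open>auto intro!: mult_nonneg_nonneg add_nonneg_nonneg zero_le_power\<close>)
    also have "\<dots> = real (n + 1) * exp (real s * ln c + real s + (real t * ln (1 / y) + real s * y)
        + (- (c * (real s - real t) * (1 - \<sigma>))))"
      by (simp only: exp_add mult.assoc)
    also have "\<dots> \<le> real (n + 1) * exp (\<kappa> / 2 - \<kappa> * \<sigma> / 2 * real n)"
    proof (intro mult_left_mono)
      have "real t * ln (1 / y) + c * real t = real t * (c + ln (1 / y))" by (simp add: algebra_simps)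
      also have "\<dots> \<le> \<tau> * real s * (c + ln (1 / y))"
        using t(1) c ly by (intro mult_right_mono) auto
      also have "\<dots> \<le> real s * (\<kappa> / 8)"
        using mult_left_mono[OF \<tau>(3), of "real s"] by (simp add: mult_ac)
      finally have 1: "real t * ln (1 / y) + c * real t \<le> real s * (\<kappa> / 8)" .
      have 2: "real s * y \<le> real s * (\<kappa> / 8)" using y by (intro mult_left_mono) auto
      have 3: "real s * (c * \<sigma>) \<le> real s * (\<kappa> / 8)" using \<sigma> by (intro mult_left_mono) auto
      have 4: "0 \<le> c * real t * \<sigma>" using c \<sigma> by simp
      have "real s * ln c + real s + (real t * ln (1 / y) + real s * y) + (- (c * (real s - real t) * (1 - \<sigma>)))
          = - (real s * \<kappa>) + (real t * ln (1 / y) + c * real t) + real s * y + real s * (c * \<sigma>) - c * real t * \<sigma>"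
        by (simp add: \<kappa>_def algebra_simps)
      also have "\<dots> \<le> - (real s * (\<kappa> / 2))" 
      proof -
        have "real s * \<kappa> = 8 * (real s * (\<kappa> / 8))" "real s * (\<kappa> / 2) = 4 * (real s * (\<kappa> / 8))" "0 \<le> real s * (\<kappa> / 8)"
          using \<kappa> by auto
        then show ?thesis using 1 2 3 4 by linarith
      qed
      also have "\<dots> \<le> \<kappa> / 2 - \<kappa> * \<sigma> / 2 * real n"
        using mult_right_mono[of "\<sigma> * real n - 1" "real s" "\<kappa> / 2"] s(2) \<kappa> by (simp add: algebra_simps)
      finally show "exp (real s * ln c + real s + (real t * ln (1 / y) + real s * y)
          + (- (c * (real s - real t) * (1 - \<sigma>)))) \<le> exp (\<kappa> / 2 - \<kappa> * \<sigma> / 2 * real n)"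
        by simp
    qed simp
    also have "exp (\<kappa> / 2 - \<kappa> * \<sigma> / 2 * real n) = exp (\<kappa> / 2) * x ^ n"
    proof -
      have "x ^ n = exp (- (\<kappa> * \<sigma> / 2 * real n))"
        by (simp add: x_def mult.commute flip: exp_of_nat_mult)
      then show ?thesis by (simp flip: exp_add)
    qed
    finally show ?thesis .
  qed
  have lim: "(\<lambda>n. real (n + 1) * (exp (\<kappa> / 2) * x ^ n)) \<longlonglongrightarrow> 0"
  proof -
    have "(\<lambda>n. real n * x ^ n) \<longlonglongrightarrow> 0" "(\<lambda>n. x ^ n) \<longlonglongrightarrow> 0"
      using x by (auto intro!: powser_times_n_limit_0 LIMSEQ_power_zero)
    then have "(\<lambda>n. exp (\<kappa> / 2) * (real n * x ^ n + x ^ n)) \<longlonglongrightarrow> exp (\<kappa> / 2) * (0 + 0)"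
      by (intro tendsto_mult_left tendsto_add)
    then show ?thesis by (simp add: algebra_simps)
  qed
  have ev: "\<forall>\<^sub>F n in sequentially. real n \<ge> c \<and> real n \<ge> 2 / \<sigma>"
    using filterlim_real_sequentially by (intro eventually_conj) (simp_all add: filterlim_at_top)
  have "?pr \<longlonglongrightarrow> 0"
  proof (rule tendsto_sandwich[OF _ _ tendsto_const lim])
    show "\<forall>\<^sub>F n in sequentially. 0 \<le> ?pr n"
      using ev by eventually_elim (use c in \<open>intro rs_expect_nonneg; auto\<close>)
    show "\<forall>\<^sub>F n in sequentially. ?pr n \<le> real (n + 1) * (exp (\<kappa> / 2) * x ^ n)"
      using ev by eventually_elim (use bound in blast)
  qed
  moreover have "\<theta> > 0" using \<tau> \<sigma> by (simp add: \<theta>_def)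
  ultimately show ?thesis by blast
qed

section \<open>Random connectors\<close>

text \<open>The weight \<open>y\<close> is chosen with \<open>4 ^ R * y = 4 ^ s\<close>. Then
  \<open>(1 + y) ^ card ?X\<close> costs only \<open>exp 1\<close> per element of a largest set, and
  the choice of an element costs \<open>4 ^ (R - s)\<close>. This count dictates the number of
  connectors needed at level \<open>s\<close>.\<close>

lemma card_small_edge_sets_le:
  assumes "s \<le> R"
  shows "real (card {U. U \<subseteq> pairs_on {..<2 ^ R :: nat} \<and> card U \<le> 4 ^ s}) \<le> 4 ^ ((R - s + 1) * 4 ^ s)"
proof -
  let ?X = "pairs_on {..<2 ^ R :: nat}"
  define y :: real where "y = 1 / 4 ^ (R - s)"
  have y: "0 < y" "y \<le> 1" by (simp_all add: y_def)
  have "card ?X \<le> 4 ^ R"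
  proof -
    have "card ?X \<le> 2 ^ R * 2 ^ R"
      by (simp add: card_pairs_on choose_two div_le_dividend order_trans[OF div_le_dividend])
    then show ?thesis by (simp flip: power_mult_distrib)
  qed
  then have "(1 + y) ^ card ?X \<le> (1 + y) ^ (4 ^ R)" using y by (intro power_increasing) auto
  also have "\<dots> \<le> exp y ^ (4 ^ R)" using y by (intro power_mono) auto
  also have "\<dots> = exp (real (4 ^ R) * y)" by (simp only: exp_of_nat_mult)
  also have "real (4 ^ R) * y = real (4 ^ s)"
  proof -
    have "(4::real) ^ R = 4 ^ s * 4 ^ (R - s)" using assms by (simp flip: power_add)
    then show ?thesis by (simp add: y_def)
  qed
  also have "exp (real (4 ^ s)) = exp 1 ^ (4 ^ s)" by (simp add: exp_of_nat_mult flip: exp_of_nat_mult)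
  also have "\<dots> \<le> 4 ^ (4 ^ s)" using exp_le by (intro power_mono) auto
  finally have 1: "(1 + y) ^ card ?X \<le> 4 ^ (4 ^ s)" .
  have "real (card {U. U \<subseteq> ?X \<and> card U \<le> 4 ^ s}) \<le> (1 / y) ^ (4 ^ s) * (1 + y) ^ card ?X"
    by (intro card_small_subsets_le finite_pairs_on y) simp
  also have "\<dots> \<le> (4 ^ (R - s)) ^ (4 ^ s) * 4 ^ (4 ^ s)"
    using 1 by (intro mult_mono) (auto simp: y_def)
  also have "\<dots> = 4 ^ ((R - s + 1) * 4 ^ s)"
    by (simp add: add_mult_distrib power_add power_mult)
  finally show ?thesis .
qed

lemma inj_on_doubleton:
  assumes "A \<inter> B = {}"
  shows "inj_on (\<lambda>(a, b). {a, b}) (A \<times> B)"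
  using assms by (auto simp: inj_on_def doubleton_eq_iff)

text \<open>For fixed \<open>U\<close> different connectors depend on disjoint sets
  \<open>C x\<close> of possible edges, so they fail independently, each with probability at most
  1/16. With \<open>a = (R - s + 1) * 4 ^ s\<close> and \<open>M = 2 * a\<close>, a fixed
  \<open>U\<close> defeats \<open>M\<close> connectors with probability at most
  \<open>(1 / 4) ^ (2 * a)\<close>, and there are at most \<open>4 ^ a\<close> sets
  \<open>U\<close>.\<close>

lemma rs_prob_not_connecting_level:
  fixes S T :: "nat \<Rightarrow> nat set"
  assumes p: "0 \<le> p" "p \<le> 1" and s: "s \<le> R" and M: "M = 2 * ((R - s + 1) * 4 ^ s)"
    and S: "disjoint_family_on S {..<2 ^ R}" "\<And>i. i < 2 ^ R \<Longrightarrow> S i \<subseteq> {..<n} \<and> card (S i) = h"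
    and T: "disjoint_family_on T {..<2 * M}" "\<And>x. x < 2 * M \<Longrightarrow> T x \<subseteq> {..<n} \<and> card (T x) = m"
    and ST: "\<And>i x. i < 2 ^ R \<Longrightarrow> x < 2 * M \<Longrightarrow> S i \<inter> T x = {}"
    and large: "8192 / 2 ^ s \<le> p * (real h * real m)"
  shows "rs_prob (vertex_pairs n) p
      (\<lambda>E. \<not> connecting_level (2 ^ R) s M (\<lambda>x i. \<exists>a\<in>S i. \<exists>b\<in>T x. {a, b} \<in> E))
    \<le> (1 / 4) ^ ((R - s + 1) * 4 ^ s)"
proof -
  define a where "a = (R - s + 1) * 4 ^ s"
  define B where "B x i = (\<lambda>(a, b). {a, b}) ` (S i \<times> T x)" for x i
  define C where "C x = (\<Union>i<2 ^ R. B x i)" for x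
  define q where "q = 1 - (1 - p) ^ (h * m)"
  have finS: "finite (S i)" if "i < 2 ^ R" for i using S(2)[OF that] finite_subset by blast
  have finT: "finite (T x)" if "x < 2 * M" for x using T(2)[OF that] finite_subset by blast
  have B: "finite (B x i)" "card (B x i) = h * m" "B x i \<subseteq> vertex_pairs n"
    if "x < 2 * M" "i < 2 ^ R" for x i
  proof -
    show "finite (B x i)" unfolding B_def using finS finT that by blast
    show "card (B x i) = h * m"
      unfolding B_def using card_image[OF inj_on_doubleton[OF ST[OF that(2,1)]]] S(2)[OF that(2)] T(2)[OF that(1)]
      by (simp add: card_cartesian_product)
    have "{a, b} \<in> vertex_pairs n" if ab: "a \<in> S i" "b \<in> T x" for a b
    proof -
      have "a \<noteq> b" using ab ST[OF \<open>i < 2 ^ R\<close> \<open>x < 2 * M\<close>] by blast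
      moreover have "a < n" "b < n" using ab S(2)[OF \<open>i < 2 ^ R\<close>] T(2)[OF \<open>x < 2 * M\<close>] by auto
      ultimately show ?thesis by (simp add: vertex_pairs_def)
    qed
    then show "B x i \<subseteq> vertex_pairs n" unfolding B_def by auto
  qed
  have disjB: "B x i \<inter> B x' i' = {}"
    if "x < 2 * M" "i < 2 ^ R" "x' < 2 * M" "i' < 2 ^ R" "(x, i) \<noteq> (x', i')" for x i x' i'
  proof (rule ccontr)
    assume "B x i \<inter> B x' i' \<noteq> {}"
    then obtain a b a' b' where ab: "a \<in> S i" "b \<in> T x" "a' \<in> S i'" "b' \<in> T x'" "{a, b} = {a', b'}"
      unfolding B_def by auto
    have "S i \<inter> T x' = {}" using ST that by blast
    then have "a = a'" "b = b'" using ab by (auto simp: doubleton_eq_iff)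
    then have "S i \<inter> S i' \<noteq> {}" "T x \<inter> T x' \<noteq> {}" using ab by blast+
    then have "i = i'" "x = x'"
      using disjoint_family_onD[OF S(1), of i i'] disjoint_family_onD[OF T(1), of x x'] that by auto
    then show False using that by simp
  qed
  have touch: "(\<exists>a\<in>S i. \<exists>b\<in>T x. {a, b} \<in> E) \<longleftrightarrow> E \<inter> C x \<inter> B x i \<noteq> {}" if "i < 2 ^ R" for x i E
  proof -
    have "(\<exists>a\<in>S i. \<exists>b\<in>T x. {a, b} \<in> E) \<longleftrightarrow> E \<inter> B x i \<noteq> {}" unfolding B_def by auto
    moreover have "B x i \<subseteq> C x" using that by (auto simp: C_def)
    ultimately show ?thesis by blast
  qed
  have finC: "finite (C x)" if "x < 2 * M" for x unfolding C_def using B that by auto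
  have disjC: "disjoint_family_on C {..<2 * M}"
    unfolding disjoint_family_on_def
  proof (intro ballI impI)
    fix x x' assume x: "x \<in> {..<2 * M}" "x' \<in> {..<2 * M}" "x \<noteq> x'"
    then have "B x i \<inter> B x' i' = {}" if "i < 2 ^ R" "i' < 2 ^ R" for i i' using disjB[of x i x' i'] that by auto
    then show "C x \<inter> C x' = {}" unfolding C_def by blast
  qed
  have q: "1 - exp (- (8192 / 2 ^ s)) \<le> q" "q \<le> 1"
  proof -
    have "(1 - p) ^ (h * m) \<le> exp (- p) ^ (h * m)"
      using p exp_ge_add_one_self[of "- p"] by (intro power_mono) auto
    also have "\<dots> = exp (- (p * (real h * real m)))" by (simp add: mult_ac flip: exp_of_nat_mult)
    also have "\<dots> \<le> exp (- (8192 / 2 ^ s))" using large by simp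
    finally show "1 - exp (- (8192 / 2 ^ s)) \<le> q" by (simp add: q_def)
    show "q \<le> 1" using p by (simp add: q_def)
  qed
  define \<U> where "\<U> = {U. U \<subseteq> pairs_on {..<2 ^ R :: nat} \<and> 4 ^ s < 4 * card U \<and> card U \<le> 4 ^ s \<and>
      (\<forall>v<2 ^ R. card {e\<in>U. v \<in> e} \<le> 8 * 2 ^ s)}"
  define F where "F U x X \<longleftrightarrow> \<not> (\<exists>e\<in>U. \<forall>i\<in>e. X \<inter> B x i \<noteq> {})" for U x and X :: "nat set set"
  have finP: "finite {U. U \<subseteq> pairs_on {..<2 ^ R :: nat} \<and> card U \<le> 4 ^ s}"
    by (rule finite_subset[of _ "Pow (pairs_on {..<2 ^ R})"]) (auto simp: finite_pairs_on)
  have \<U>_sub: "\<U> \<subseteq> {U. U \<subseteq> pairs_on {..<2 ^ R} \<and> card U \<le> 4 ^ s}" unfolding \<U>_def by blast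
  have fin\<U>: "finite \<U>" by (rule finite_subset[OF \<U>_sub finP])
  have fail: "rs_prob (C x) p (F U x) \<le> 1 / 16" if U: "U \<in> \<U>" and x: "x < 2 * M" for U x
  proof -
    have Usub: "U \<subseteq> pairs_on {..<2 ^ R}" using U by (simp add: \<U>_def)
    have eU: "e \<subseteq> {..<2 ^ R} \<and> card e = 2" if "e \<in> U" for e
      using Usub that by (auto simp: pairs_on_def)
    have "rs_prob (C x) p (F U x)
        = rs_expect (\<Union>i\<in>{..<2 ^ R}. B x i) p (\<lambda>E. of_bool (\<not> (\<exists>e\<in>U. e \<subseteq> {i\<in>{..<2 ^ R}. E \<inter> B x i \<noteq> {}})))"
      unfolding C_def
    proof (intro rs_expect_cong arg_cong[of _ _ of_bool])
      fix E
      have "(\<forall>i\<in>e. E \<inter> B x i \<noteq> {}) \<longleftrightarrow> e \<subseteq> {i\<in>{..<2 ^ R}. E \<inter> B x i \<noteq> {}}" if "e \<in> U" for e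
        using eU[OF that] by auto
      then show "F U x E \<longleftrightarrow> \<not> (\<exists>e\<in>U. e \<subseteq> {i\<in>{..<2 ^ R}. E \<inter> B x i \<noteq> {}})"
        unfolding F_def by (intro arg_cong[of _ _ Not] bex_cong refl)
    qed
    also have "\<dots> = rs_prob {..<2 ^ R} q (\<lambda>N. \<not> (\<exists>e\<in>U. e \<subseteq> N))"
      unfolding q_def
    proof (rule rs_expect_hit[where g = "\<lambda>N. of_bool (\<not> (\<exists>e\<in>U. e \<subseteq> N))"])
      show "disjoint_family_on (B x) {..<2 ^ R}"
        unfolding disjoint_family_on_def using disjB x by auto
    qed (use B x in auto)
    also have "\<dots> \<le> 1 / 16"
      using U eU q finite_subset[OF Usub finite_pairs_on]
      by (intro rs_prob_independent_le_16[where s = s]) (auto simp: \<U>_def)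
    finally show ?thesis .
  qed
  have "rs_prob (vertex_pairs n) p
      (\<lambda>E. \<not> connecting_level (2 ^ R) s M (\<lambda>x i. \<exists>a\<in>S i. \<exists>b\<in>T x. {a, b} \<in> E))
    \<le> (\<Sum>U\<in>\<U>. rs_prob (vertex_pairs n) p (\<lambda>E. M \<le> card {x\<in>{..<2 * M}. F U x (E \<inter> C x)}))"
  proof (rule rs_prob_union_bound[OF p fin\<U>])
    fix E assume "\<not> connecting_level (2 ^ R) s M (\<lambda>x i. \<exists>a\<in>S i. \<exists>b\<in>T x. {a, b} \<in> E)"
    then obtain U where U: "U \<in> \<U>"
      and M: "\<not> card {x\<in>{..<2 * M}. \<not> (\<exists>e\<in>U. \<forall>i\<in>e. \<exists>a\<in>S i. \<exists>b\<in>T x. {a, b} \<in> E)} < M"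
      unfolding connecting_level_def \<U>_def by blast
    have "(\<exists>e\<in>U. \<forall>i\<in>e. \<exists>a\<in>S i. \<exists>b\<in>T x. {a, b} \<in> E) \<longleftrightarrow> (\<exists>e\<in>U. \<forall>i\<in>e. E \<inter> C x \<inter> B x i \<noteq> {})" for x
    proof (intro bex_cong ball_cong refl touch)
      fix e i assume "e \<in> U" "i \<in> e"
      then show "i < 2 ^ R" using U by (auto simp: \<U>_def pairs_on_def)
    qed
    then have "M \<le> card {x\<in>{..<2 * M}. F U x (E \<inter> C x)}" using M unfolding F_def by simp
    then show "\<exists>U\<in>\<U>. M \<le> card {x\<in>{..<2 * M}. F U x (E \<inter> C x)}" using U by blast
  qed
  also have "\<dots> \<le> (\<Sum>U\<in>\<U>. (1 / 4) ^ M)"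
  proof (intro sum_mono)
    fix U assume U: "U \<in> \<U>"
    have "C x \<subseteq> vertex_pairs n" if "x < 2 * M" for x
      unfolding C_def using B(3)[OF that] by blast
    then have "(\<Union>x<2 * M. C x) \<subseteq> vertex_pairs n" by blast
    then show "rs_prob (vertex_pairs n) p (\<lambda>E. M \<le> card {x\<in>{..<2 * M}. F U x (E \<inter> C x)}) \<le> (1 / 4) ^ M"
      by (intro rs_prob_many_failures_le finite_vertex_pairs finC disjC p fail[OF U])
  qed
  also have "\<dots> \<le> 4 ^ a * (1 / 4) ^ M"
  proof -
    have "real (card \<U>) \<le> 4 ^ a"
      using card_small_edge_sets_le[OF s] card_mono[OF finP \<U>_sub] unfolding a_def by linarith
    then show ?thesis by (simp add: mult_right_mono)
  qed
  also have "\<dots> = (1 / 4) ^ a"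
  proof -
    have "(1 / 4 :: real) ^ M = (1 / 4) ^ a * (1 / 4) ^ a" by (simp only: M a_def mult_2 power_add)
    moreover have "(4::real) ^ a * (1 / 4) ^ a = 1" by (simp flip: power_mult_distrib)
    ultimately show ?thesis by (simp only: mult.assoc[symmetric] mult_1)
  qed
  finally show ?thesis by (simp add: a_def)
qed

lemma sum_quarter_powers_le: "(\<Sum>s\<le>R. (1 / 4 :: real) ^ ((R - s + 1) * 4 ^ s)) \<le> (1 / 2) ^ (R + 1)"
proof -
  have "(\<Sum>s\<le>R. (1 / 4 :: real) ^ ((R - s + 1) * 4 ^ s)) \<le> (\<Sum>s\<le>R. (1 / 4) ^ (R + 1))"
  proof (intro sum_mono power_decreasing)
    fix s assume "s \<in> {..R}"
    \<comment> \<open>The product is \<open>R + 1 + (R - s) * s\<close>.\<close>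
    then have "R + 1 \<le> (R - s + 1) * (s + 1)"
      by (auto simp: algebra_simps dest!: le_Suc_ex)
    also have "s + 1 \<le> 4 ^ s"
    proof (induction s)
      case (Suc s)
      then show ?case by simp
    qed simp
    then have "(R - s + 1) * (s + 1) \<le> (R - s + 1) * 4 ^ s" by (rule mult_le_mono2)
    finally show "R + 1 \<le> (R - s + 1) * 4 ^ s" .
  qed auto
  also have "\<dots> = real (R + 1) * (1 / 4) ^ (R + 1)" by simp
  also have "\<dots> \<le> 2 ^ (R + 1) * (1 / 4) ^ (R + 1)"
    using of_nat_less_two_power[of "R + 1", where ?'a = real] by (intro mult_right_mono) auto
  also have "\<dots> = (1 / 2) ^ (R + 1)" by (simp flip: power_mult_distrib)
  finally show ?thesis .
qed

text \<open>The graph \<open>E\<close> with its path is fixed and supplies connectivity inside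
  segments and connectors; only the independent graph \<open>E'\<close> is random and supplies the
  contacts between them. A union bound over the levels lets the deterministic assignment succeed for
  all of them at once.\<close>

lemma rs_prob_ccl_path:
  fixes m :: "nat \<Rightarrow> nat"
  assumes p: "0 \<le> p" "p \<le> 1" and path: "is_path n E xs"
    and len: "2 ^ R * h + (\<Sum>s\<le>R. 4 * (R - s + 1) * 4 ^ s * m s) \<le> length xs"
    and pos: "1 \<le> h" "\<And>s. s \<le> R \<Longrightarrow> 1 \<le> m s"
    and large: "\<And>s. s \<le> R \<Longrightarrow> 8192 / 2 ^ s \<le> p * (real h * real (m s))"
  shows "rs_prob (vertex_pairs n) p (\<lambda>E'. \<not> 2 ^ R \<le> 2 * ccl n (E \<union> E')) \<le> (1 / 2) ^ (R + 1)"
proof -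
  define M where "M s = 2 * ((R - s + 1) * 4 ^ s)" for s
  define Q where "Q = (SIGMA s:{..R}. {..<2 * M s})"
  \<comment> \<open>The sum type indexes segments on the left and connectors on the right, the
    latter by level and number, so that one cutting of the path yields both families.\<close>
  define size where "size = case_sum (\<lambda>_::nat. h) (\<lambda>(s, x::nat). m s)"
  have finQ: "finite Q" by (simp add: Q_def)
  have path': "distinct xs" "successively (\<lambda>x y. {x, y} \<in> E) xs" "set xs \<subseteq> {..<n}"
    using path by (auto simp: is_path_def)
  have "sum size ({..<2 ^ R} <+> Q) = 2 ^ R * h + (\<Sum>q\<in>Q. m (fst q))"
    using finQ by (simp add: sum.Plus size_def case_prod_unfold)
  also have "(\<Sum>q\<in>Q. m (fst q)) = (\<Sum>s\<le>R. \<Sum>x<2 * M s. m s)"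
    unfolding Q_def by (subst sum.Sigma) (auto simp: case_prod_unfold)
  also have "\<dots> = (\<Sum>s\<le>R. 4 * (R - s + 1) * 4 ^ s * m s)"
    by (intro sum.cong) (auto simp: M_def algebra_simps)
  finally have "sum size ({..<2 ^ R} <+> Q) \<le> length xs" using len by simp
  moreover have "1 \<le> size i" if "i \<in> {..<2 ^ R} <+> Q" for i
    using that pos by (auto simp: size_def Q_def)
  ultimately obtain P where P: "disjoint_family_on P ({..<2 ^ R} <+> Q)"
    "\<And>i. i \<in> {..<2 ^ R} <+> Q \<Longrightarrow> P i \<subseteq> set xs \<and> card (P i) = size i \<and> connected_in E (P i)"
    using path_pieces[of "{..<2 ^ R} <+> Q" size xs E] finQ path' by auto
  define S where "S = P \<circ> Inl"
  define T where "T = P \<circ> Inr"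
  have disj: "disjoint_family_on S {..<2 ^ R}" "disjoint_family_on T Q"
    "\<And>i q. i < 2 ^ R \<Longrightarrow> q \<in> Q \<Longrightarrow> S i \<inter> T q = {}"
  proof -
    have disj: "P u \<inter> P v = {}" if "u \<in> {..<2 ^ R} <+> Q" "v \<in> {..<2 ^ R} <+> Q" "u \<noteq> v" for u v
      using disjoint_family_onD[OF P(1)] that by blast
    show "disjoint_family_on S {..<2 ^ R}" "disjoint_family_on T Q"
      unfolding disjoint_family_on_def S_def T_def o_def by (intro ballI impI disj; auto)+
    show "S i \<inter> T q = {}" if "i < 2 ^ R" "q \<in> Q" for i q
      unfolding S_def T_def o_def using that by (intro disj) auto
  qed
  have S: "S i \<subseteq> {..<n} \<and> card (S i) = h" "connected_in E (S i)" if "i < 2 ^ R" for i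
    using P(2)[of "Inl i"] that path'(3) by (auto simp: S_def size_def)
  have T: "T q \<subseteq> {..<n} \<and> card (T q) = m (fst q)" "connected_in E (T q)" if "q \<in> Q" for q
    using P(2)[of "Inr q"] that path'(3) by (auto simp: T_def size_def case_prod_unfold)
  define \<tau> where "\<tau> E' s x i \<longleftrightarrow> (\<exists>a\<in>S i. \<exists>b\<in>T (s, x). {a, b} \<in> E')" for E' s x i
  have minor: "2 ^ R \<le> 2 * ccl n (E \<union> E')"
    if levels: "\<And>s. s \<le> R \<Longrightarrow> connecting_level (2 ^ R) s (M s) (\<tau> E' s)" for E'
  proof -
    have "4 ^ s \<le> M s" for s by (simp add: M_def)
    then obtain K \<phi> where K: "K \<subseteq> {..<2 ^ R}" "2 ^ R \<le> 2 * card K" "inj_on \<phi> (pairs_on K)"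
      and \<phi>: "\<And>e. e \<in> pairs_on K \<Longrightarrow> fst (\<phi> e) \<le> R \<and> snd (\<phi> e) < 2 * M (fst (\<phi> e)) \<and>
        (\<forall>i\<in>e. \<tau> E' (fst (\<phi> e)) (snd (\<phi> e)) i)"
      using connecting_levels_complete[of R M "\<tau> E'", OF levels] by blast
    have mono: "connected_in E X \<Longrightarrow> connected_in (E \<union> E') X" for X
      by (rule connected_in_mono) auto
    have "has_complete_minor n (E \<union> E') (card K)"
    proof (rule has_complete_minor_of_connectors[where S = S and T = T and Q = Q and \<phi> = \<phi>])
      show "finite K" using K(1) finite_subset by blast
      show "disjoint_family_on S K" using disj(1) K(1) by (rule disjoint_family_on_mono[rotated])
      show "inj_on \<phi> {e. e \<subseteq> K \<and> card e = 2}" using K(3) by (simp add: pairs_on_def)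
      fix e assume "e \<subseteq> K" "card e = 2"
      then have e: "e \<in> pairs_on K" by (simp add: pairs_on_def)
      have "\<phi> e \<in> Q" using \<phi>[OF e] by (cases "\<phi> e") (simp add: Q_def)
      then show "\<phi> e \<in> Q \<and> (\<forall>i\<in>e. \<exists>x\<in>S i. \<exists>y\<in>T (\<phi> e). {x, y} \<in> E \<union> E')"
        using \<phi>[OF e] by (simp add: \<tau>_def) blast
    qed (use disj S T K(1) mono in blast)+
    then show ?thesis using K(2) has_complete_minor_le_ccl by (meson le_trans mult_le_mono2)
  qed
  have "rs_prob (vertex_pairs n) p (\<lambda>E'. \<not> 2 ^ R \<le> 2 * ccl n (E \<union> E'))
      \<le> (\<Sum>s\<le>R. rs_prob (vertex_pairs n) p (\<lambda>E'. \<not> connecting_level (2 ^ R) s (M s) (\<tau> E' s)))"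
    using minor by (intro rs_prob_union_bound[OF p]) auto
  also have "\<dots> \<le> (\<Sum>s\<le>R. (1 / 4) ^ ((R - s + 1) * 4 ^ s))"
  proof (intro sum_mono)
    fix s assume "s \<in> {..R}"
    then have s: "s \<le> R" by simp
    have sQ: "(s, x) \<in> Q" if "x < 2 * M s" for x using s that by (simp add: Q_def)
    show "rs_prob (vertex_pairs n) p (\<lambda>E'. \<not> connecting_level (2 ^ R) s (M s) (\<tau> E' s))
        \<le> (1 / 4) ^ ((R - s + 1) * 4 ^ s)"
      unfolding \<tau>_def
    proof (rule rs_prob_not_connecting_level[OF p s M_def disj(1) S(1)])
      show "disjoint_family_on (\<lambda>x. T (s, x)) {..<2 * M s}"
        using disj(2) sQ unfolding disjoint_family_on_def by auto
      show "T (s, x) \<subseteq> {..<n} \<and> card (T (s, x)) = m s" if "x < 2 * M s" for x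
        using T(1)[OF sQ[OF that]] by simp
      show "S i \<inter> T (s, x) = {}" if "i < 2 ^ R" "x < 2 * M s" for i x
        using disj(3) sQ that by blast
      show "8192 / 2 ^ s \<le> p * (real h * real (m s))" by (rule large[OF s])
    qed
  qed
  also have "\<dots> \<le> (1 / 2) ^ (R + 1)" by (rule sum_quarter_powers_le)
  finally show ?thesis .
qed

lemma sum_weighted_powers: "(\<Sum>s\<le>R. real (R - s + 1) * 2 ^ s) \<le> 4 * 2 ^ R"
proof -
  \<comment> \<open>The exact value is proved because the bare inequality does not carry through the
    induction.\<close>
  have "(\<Sum>s\<le>R. real (R - s + 1) * 2 ^ s) + real R + 3 = 4 * 2 ^ R"
  proof (induction R)
    case (Suc R)
    have "(\<Sum>s\<le>Suc R. real (Suc R - s + 1) * 2 ^ s)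
        = (\<Sum>s\<le>R. real (R - s + 1) * 2 ^ s + 2 ^ s) + 2 ^ Suc R"
      by (auto simp: Suc_diff_le algebra_simps intro!: sum.cong)
    also have "\<dots> = (\<Sum>s\<le>R. real (R - s + 1) * 2 ^ s) + (2 ^ Suc R - 1) + 2 ^ Suc R"
      using sum_gp_basic[of "2::real" R] by (simp add: sum.distrib)
    finally show ?case using Suc.IH by simp
  qed simp
  then show ?thesis by simp
qed

section \<open>The order of the largest complete minor\<close>

lemma real_choose_two: "2 * real (n choose 2) = real n * (real n - 1)"
  by (induction n) (simp_all add: numeral_2_eq_2 algebra_simps)

lemma gnp_prob_eq: "gnp_prob n p P = rs_prob (vertex_pairs n) p P"
proof -
  have "{E. E \<subseteq> vertex_pairs n \<and> P E} = {E \<in> Pow (vertex_pairs n). P E}" by auto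
  then show ?thesis
    unfolding gnp_prob_def rs_expect_def
    by (simp only: sum.inter_filter[OF finite_Pow_iff[THEN iffD2, OF finite_vertex_pairs]])
      (auto intro: sum.cong)
qed

text \<open>Exponential Markov inequality with base 2; it works since \<open>exp (1 / 2) < 2\<close>.\<close>

lemma rs_prob_many_edges_le:
  assumes c: "0 < c" "c \<le> real n"
  shows "rs_prob (vertex_pairs n) (c / real n) (\<lambda>E. \<not> real (card E) \<le> c * real n) \<le> exp (- (c / 10)) ^ n"
proof -
  define p where "p = c / real n"
  have n: "0 < real n" using c by linarith
  have p: "0 \<le> p" "p \<le> 1" using c n by (auto simp: p_def)
  define a where "a = 2 powr (c * real n)"
  have a: "0 < a" by (simp add: a_def)
  have "a * rs_prob (vertex_pairs n) p (\<lambda>E. \<not> real (card E) \<le> c * real n)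
      = rs_expect (vertex_pairs n) p (\<lambda>E. a * of_bool (\<not> real (card E) \<le> c * real n))"
    by (simp only: rs_expect_cmult)
  also have "\<dots> \<le> rs_expect (vertex_pairs n) p (\<lambda>E. 2 ^ card E)"
  proof (intro rs_expect_mono p)
    fix E
    have "a \<le> 2 ^ card E" if "\<not> real (card E) \<le> c * real n"
    proof -
      have "a \<le> 2 powr real (card E)" unfolding a_def using that by (intro powr_mono) auto
      then show ?thesis by (simp add: powr_realpow)
    qed
    then show "a * of_bool (\<not> real (card E) \<le> c * real n) \<le> 2 ^ card E" by simp
  qed
  also have "\<dots> = (1 + p) ^ (n choose 2)"
    by (simp add: rs_expect_power_card[OF finite_vertex_pairs] card_vertex_pairs add.commute)
  also have "\<dots> \<le> exp p ^ (n choose 2)" using p by (intro power_mono) auto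
  also have "\<dots> = exp (p * real (n choose 2))" by (simp add: mult.commute flip: exp_of_nat_mult)
  also have "\<dots> \<le> exp (c * real n / 2)"
  proof -
    have "2 * real (n choose 2) \<le> real n * real n"
      unfolding real_choose_two by (intro mult_left_mono) auto
    then have "real (n choose 2) \<le> real n * real n / 2" by simp
    then have "p * real (n choose 2) \<le> p * (real n * real n / 2)" using p by (intro mult_left_mono) auto
    then show ?thesis using n by (simp add: p_def)
  qed
  finally have 1: "a * rs_prob (vertex_pairs n) p (\<lambda>E. \<not> real (card E) \<le> c * real n) \<le> exp (c * real n / 2)" .
  have "exp (c * real n / 2) \<le> a * exp (- (c / 10)) ^ n"
  proof -
    \<comment> \<open>From \<open>exp 3 \<le> 27 \<le> 32\<close>. The excess of 3/5 over 1/2 is the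
      1/10 in the decay rate.\<close>
    have ln2: "3 / 5 \<le> ln (2::real)"
    proof -
      have "exp (3::real) \<le> 2 ^ 5"
      proof -
        have "exp (3::real) = exp 1 ^ 3" by (simp flip: exp_of_nat_mult)
        also have "\<dots> \<le> 3 ^ 3" using exp_le by (intro power_mono) auto
        finally show ?thesis by simp
      qed
      then have "3 \<le> ln ((2::real) ^ 5)" using ln_ge_iff[of "2 ^ 5" 3] by simp
      then show ?thesis by (subst (asm) ln_realpow) auto
    qed
    have "c * real n / 2 \<le> c * real n * ln 2 - c / 10 * real n"
      using mult_left_mono[OF ln2, of "c * real n"] c n by (simp add: algebra_simps)
    then have "exp (c * real n / 2) \<le> exp (c * real n * ln 2) * exp (- (c / 10 * real n))"
      by (simp flip: exp_add)
    also have "exp (- (c / 10 * real n)) = exp (- (c / 10)) ^ n"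
      by (simp add: mult.commute flip: exp_of_nat_mult)
    finally show ?thesis by (simp add: a_def powr_def)
  qed
  with 1 have "a * rs_prob (vertex_pairs n) p (\<lambda>E. \<not> real (card E) \<le> c * real n) \<le> a * exp (- (c / 10)) ^ n"
    by linarith
  then show ?thesis using a by (simp add: p_def)
qed

text \<open>With \<open>r = sqrt (c * n)\<close>, a minor of order \<open>k > 2 * r\<close> would
  force \<open>k * (k - 1) \<le> 2 * r * r\<close>, whereas \<open>2 * r * (2 * r - 1)\<close> is
  already at least \<open>2 * r * r\<close> because \<open>r \<ge> 1\<close>.\<close>

lemma ccl_le_of_card_le:
  assumes "finite E" "real (card E) \<le> c * real n" "1 \<le> c * real n"
  shows "real (ccl n E) \<le> 2 * sqrt (c * real n)"
proof (rule ccontr)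
  define k where "k = real (ccl n E)"
  define r where "r = sqrt (c * real n)"
  have r: "1 \<le> r" "r * r = c * real n" using assms(3) by (auto simp: r_def)
  assume "\<not> real (ccl n E) \<le> 2 * sqrt (c * real n)"
  then have k: "2 * r < k" by (simp add: k_def r_def)
  have "ccl n E choose 2 \<le> card E"
    using has_complete_minor_edges[OF has_complete_minor_ccl assms(1)] .
  then have "real (ccl n E choose 2) \<le> r * r" using assms(2) r by linarith
  moreover have "real (ccl n E choose 2) = k * (k - 1) / 2"
    using real_choose_two[of "ccl n E"] by (simp add: k_def)
  ultimately have "k * (k - 1) \<le> 2 * (r * r)" by simp
  moreover have "(2 * r) * (2 * r - 1) < k * (k - 1)" using k r by (intro mult_strict_mono) auto
  moreover have "2 * (r * r) \<le> (2 * r) * (2 * r - 1)"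
    using mult_left_mono[of 1 r r] r(1) by (simp add: algebra_simps)
  ultimately show False by linarith
qed

lemma rs_prob_ccl_upper_tendsto:
  fixes c :: real
  assumes "c > 1"
  shows "(\<lambda>n. rs_prob (vertex_pairs n) (c / real n) (\<lambda>E. \<not> real (ccl n E) \<le> 2 * sqrt (c * real n))) \<longlonglongrightarrow> 0"
proof (rule tendsto_sandwich[OF _ _ tendsto_const])
  have ev: "\<forall>\<^sub>F n in sequentially. c \<le> real n"
    using filterlim_real_sequentially by (simp add: filterlim_at_top)
  then show "\<forall>\<^sub>F n in sequentially.
      0 \<le> rs_prob (vertex_pairs n) (c / real n) (\<lambda>E. \<not> real (ccl n E) \<le> 2 * sqrt (c * real n))"
    by eventually_elim (use assms in \<open>intro rs_expect_nonneg; auto\<close>)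
  from ev show "\<forall>\<^sub>F n in sequentially.
      rs_prob (vertex_pairs n) (c / real n) (\<lambda>E. \<not> real (ccl n E) \<le> 2 * sqrt (c * real n)) \<le> exp (- (c / 10)) ^ n"
  proof eventually_elim
    case (elim n)
    have n: "1 \<le> real n" using elim assms by linarith
    have "1 * 1 \<le> c * real n" using assms n by (intro mult_mono) auto
    then have cn: "1 \<le> c * real n" by simp
    have "rs_prob (vertex_pairs n) (c / real n) (\<lambda>E. \<not> real (ccl n E) \<le> 2 * sqrt (c * real n))
        \<le> rs_prob (vertex_pairs n) (c / real n) (\<lambda>E. \<not> real (card E) \<le> c * real n)"
    proof (intro rs_expect_mono)
      fix E assume "E \<subseteq> vertex_pairs n"
      then have "finite E" using finite_vertex_pairs finite_subset by blast
      then show "of_bool (\<not> real (ccl n E) \<le> 2 * sqrt (c * real n)) \<le> (of_bool (\<not> real (card E) \<le> c * real n) :: real)"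
        using ccl_le_of_card_le[of E c n] cn by auto
    qed (use assms elim n in auto)
    also have "\<dots> \<le> exp (- (c / 10)) ^ n" using assms elim by (intro rs_prob_many_edges_le) auto
    finally show ?case .
  qed
  show "(\<lambda>n. exp (- (c / 10)) ^ n) \<longlonglongrightarrow> 0"
    using assms by (intro LIMSEQ_power_zero) auto
qed

text \<open>The sizes \<open>h\<close> of the segments and \<open>m s\<close> of the connectors at level \<open>s\<close> are chosen such that
  a connector touches a given segment with probability of order \<open>1 / 2 ^ s\<close>. The total size then is
  a geometric sum dominated by the level \<open>R\<close>.\<close>

lemma connector_sizes:
  fixes \<delta> \<epsilon> \<theta> :: real
  assumes \<epsilon>: "0 < \<epsilon>" and \<delta>: "0 < \<delta>" "\<delta> \<le> 16384 / \<epsilon>" "\<delta> * (1 + 524288 / \<epsilon>) \<le> \<theta>"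
    and n: "1 \<le> n" and R: "2 ^ R \<le> \<delta> * sqrt (real n)"
  obtains h :: nat and m :: "nat \<Rightarrow> nat" where "1 \<le> h" "\<And>s. s \<le> R \<Longrightarrow> 1 \<le> m s"
    "\<And>s. s \<le> R \<Longrightarrow> 8192 / 2 ^ s \<le> \<epsilon> / real n * (real h * real (m s))"
    "real (2 ^ R * h + (\<Sum>s\<le>R. 4 * (R - s + 1) * 4 ^ s * m s)) \<le> \<theta> * real n"
proof -
  define w where "w = sqrt (real n)"
  have w: "1 \<le> w" "w * w = real n" using n by (auto simp: w_def)
  define h where "h = nat \<lfloor>w\<rfloor>"
  have h1: "1 \<le> h" using w by (simp add: h_def le_nat_iff)
  have "real h = of_int \<lfloor>w\<rfloor>" using w by (simp add: h_def)
  then have h: "real h \<le> w" "w < real h + 1" by linarith+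
  have h2: "w / 2 \<le> real h" using h h1 by linarith
  \<comment> \<open>The real length for which the expected number of contacts at density
    \<open>\<epsilon> / n\<close> is exactly \<open>8192 / 2 ^ s\<close>; \<open>m s\<close> rounds
    it up.\<close>
  define z where "z s = 8192 * real n / (2 ^ s * real h * \<epsilon>)" for s
  define m where "m s = nat \<lceil>z s\<rceil>" for s
  have z: "0 < z s" for s using h1 \<epsilon> n by (simp add: z_def)
  have m: "z s \<le> real (m s)" "real (m s) < z s + 1" for s
  proof -
    have "real (m s) = of_int \<lceil>z s\<rceil>" using z[of s] by (simp add: m_def)
    then show "z s \<le> real (m s)" "real (m s) < z s + 1" by linarith+
  qed
  have m1: "1 \<le> m s" for s using m(1)[of s] z[of s] by linarith
  have large: "8192 / 2 ^ s \<le> \<epsilon> / real n * (real h * real (m s))" for s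
  proof -
    have "8192 / 2 ^ s = \<epsilon> / real n * (real h * z s)" using h1 \<epsilon> n by (simp add: z_def)
    also have "\<dots> \<le> \<epsilon> / real n * (real h * real (m s))"
      using m(1) \<epsilon> by (intro mult_left_mono) auto
    finally show ?thesis .
  qed
  have msize: "real (m s) \<le> 32768 * w / (2 ^ s * \<epsilon>)" if "s \<le> R" for s
  proof -
    have "z s = 8192 * (w * w) / (2 ^ s * real h * \<epsilon>)" by (simp add: z_def w)
    also have "\<dots> \<le> 8192 * (w * w) / (2 ^ s * (w / 2) * \<epsilon>)"
      using h2 w \<epsilon> h1 by (intro divide_left_mono mult_right_mono mult_left_mono mult_pos_pos) auto
    also have "\<dots> = 16384 * w / (2 ^ s * \<epsilon>)" using w(1) by (simp add: field_simps)
    finally have "z s \<le> 16384 * w / (2 ^ s * \<epsilon>)" .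
    \<comment> \<open>Rounding up adds less than 1, so it at most doubles the bound; this is where
      \<open>\<delta> \<le> 16384 / \<epsilon>\<close> enters.\<close>
    moreover have "1 \<le> 16384 * w / (2 ^ s * \<epsilon>)"
    proof -
      have "(2::real) ^ s \<le> 2 ^ R" using that by (intro power_increasing) auto
      also have "\<dots> \<le> \<delta> * w" using R by (simp add: w_def)
      also have "\<dots> \<le> 16384 / \<epsilon> * w" using \<delta> w by (intro mult_right_mono) auto
      finally show ?thesis using \<epsilon> by (simp add: field_simps)
    qed
    moreover have "32768 * w / (2 ^ s * \<epsilon>) = 16384 * w / (2 ^ s * \<epsilon>) + 16384 * w / (2 ^ s * \<epsilon>)"
      by (simp flip: add_divide_distrib)
    ultimately show ?thesis using m(2)[of s] by linarith
  qed
  have "real (\<Sum>s\<le>R. 4 * (R - s + 1) * 4 ^ s * m s) = (\<Sum>s\<le>R. 4 * (real (R - s + 1) * 4 ^ s * real (m s)))"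
    unfolding of_nat_sum
    by (intro sum.cong refl) (simp only: of_nat_mult of_nat_power of_nat_numeral mult.assoc)
  also have "\<dots> \<le> (\<Sum>s\<le>R. 131072 * w / \<epsilon> * (real (R - s + 1) * 2 ^ s))"
  proof (intro sum_mono)
    fix s assume "s \<in> {..R}"
    then have s: "s \<le> R" by simp
    define r where "r = real (R - s + 1)"
    have "r * 4 ^ s * real (m s) \<le> r * 4 ^ s * (32768 * w / (2 ^ s * \<epsilon>))"
      unfolding r_def by (intro mult_left_mono msize s) auto
    moreover have "(4::real) ^ s = 2 ^ s * 2 ^ s" by (simp flip: power_mult_distrib)
    then have "r * 4 ^ s * (32768 * w / (2 ^ s * \<epsilon>)) = 32768 * w / \<epsilon> * (r * 2 ^ s)" by simp
    moreover have "131072 * w / \<epsilon> * (r * 2 ^ s) = 4 * (32768 * w / \<epsilon> * (r * 2 ^ s))" by simp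
    ultimately show "4 * (real (R - s + 1) * 4 ^ s * real (m s)) \<le> 131072 * w / \<epsilon> * (real (R - s + 1) * 2 ^ s)"
      unfolding r_def[symmetric] by linarith
  qed
  also have "\<dots> = 131072 * w / \<epsilon> * (\<Sum>s\<le>R. real (R - s + 1) * 2 ^ s)"
    by (rule sum_distrib_left[symmetric])
  also have "\<dots> \<le> 131072 * w / \<epsilon> * (4 * 2 ^ R)"
    using w \<epsilon> by (intro mult_left_mono sum_weighted_powers) auto
  also have "\<dots> \<le> 131072 * w / \<epsilon> * (4 * (\<delta> * w))"
    using w \<epsilon> R by (intro mult_left_mono) (auto simp: w_def)
  also have "\<dots> = \<delta> * (524288 / \<epsilon>) * real n" by (simp add: w(2)[symmetric])
  finally have total: "real (\<Sum>s\<le>R. 4 * (R - s + 1) * 4 ^ s * m s) \<le> \<delta> * (524288 / \<epsilon>) * real n" .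
  have "2 ^ R * real h \<le> (\<delta> * w) * w"
    using R h \<delta> w by (intro mult_mono) (auto simp: w_def)
  then have "2 ^ R * real h \<le> \<delta> * real n" by (simp add: w(2) mult.assoc)
  then have "real (2 ^ R * h + (\<Sum>s\<le>R. 4 * (R - s + 1) * 4 ^ s * m s)) \<le> \<delta> * (1 + 524288 / \<epsilon>) * real n"
    using total by (simp add: algebra_simps)
  also have "\<dots> \<le> \<theta> * real n" using \<delta> by (intro mult_right_mono) auto
  finally show thesis using that h1 m1 large by blast
qed

text \<open>The first round has density \<open>c1 / n\<close> with \<open>c1\<close> midway between
  1 and \<open>c\<close>, so it is still supercritical and yields the long path; the second round
  keeps density at least \<open>\<epsilon> / n\<close> for the contacts. The failure probability of
  the second round is at most \<open>1 / (\<delta> * sqrt n)\<close>.\<close>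

lemma rs_prob_ccl_lower_tendsto:
  fixes c :: real
  assumes c: "c > 1"
  shows "\<exists>\<delta>>0. (\<lambda>n. rs_prob (vertex_pairs n) (c / real n) (\<lambda>E. \<not> \<delta> * sqrt (real n) \<le> real (ccl n E))) \<longlonglongrightarrow> 0"
proof -
  define c1 where "c1 = (1 + c) / 2"
  define \<epsilon> where "\<epsilon> = (c - 1) / 2"
  have c1: "1 < c1" and \<epsilon>: "0 < \<epsilon>" and c_eq: "c = c1 + \<epsilon>"
    using c by (auto simp: c1_def \<epsilon>_def field_simps)
  obtain \<theta> where \<theta>: "\<theta> > 0" and path_lim: "(\<lambda>n. rs_prob (vertex_pairs n) (c1 / real n)
      (\<lambda>E. \<not> (\<exists>xs. is_path n E xs \<and> \<theta> * real n \<le> real (length xs)))) \<longlonglongrightarrow> 0"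
    using rs_prob_no_long_path_tendsto[OF c1] by blast
  \<comment> \<open>The first bound keeps the rounding of connector lengths harmless, the second
    makes segments and connectors fit into a path of length \<open>\<theta> * n\<close>.\<close>
  define \<delta> where "\<delta> = min (16384 / \<epsilon>) (\<theta> / (1 + 524288 / \<epsilon>))"
  have pos: "0 < 1 + 524288 / \<epsilon>" using \<epsilon> by (simp add: add_pos_pos)
  have \<delta>: "0 < \<delta>" "\<delta> \<le> 16384 / \<epsilon>" "\<delta> * (1 + 524288 / \<epsilon>) \<le> \<theta>"
  proof -
    show "0 < \<delta>" "\<delta> \<le> 16384 / \<epsilon>" unfolding \<delta>_def using \<epsilon> \<theta> pos by simp_all
    have "\<delta> \<le> \<theta> / (1 + 524288 / \<epsilon>)" by (simp add: \<delta>_def)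
    then show "\<delta> * (1 + 524288 / \<epsilon>) \<le> \<theta>" using pos by (simp only: pos_le_divide_eq)
  qed
  let ?P1 = "\<lambda>n. rs_prob (vertex_pairs n) (c1 / real n)
      (\<lambda>E. \<not> (\<exists>xs. is_path n E xs \<and> \<theta> * real n \<le> real (length xs)))"
  \<comment> \<open>One factor 2 in \<open>\<delta> / 4\<close> is lost by rounding the number of
    segments to a power of 2, the other by discarding up to half of them.\<close>
  let ?P = "\<lambda>n. rs_prob (vertex_pairs n) (c / real n) (\<lambda>E. \<not> \<delta> / 4 * sqrt (real n) \<le> real (ccl n E))"
  have bound: "?P n \<le> ?P1 n + 1 / (\<delta> * sqrt (real n))" if n: "c < real n" "1 \<le> \<delta> * sqrt (real n)" for n
  proof -
    let ?V = "vertex_pairs n"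
    have n1: "1 \<le> n" "0 < real n" using n c by auto
    define p1 where "p1 = c1 / real n"
    \<comment> \<open>Chosen so that the union of the two rounds has density exactly
      \<open>c / n\<close>.\<close>
    define p2 where "p2 = 1 - (1 - c / real n) / (1 - p1)"
    have p1: "0 \<le> p1" "p1 < 1" using n c1 c_eq \<epsilon> n1 by (auto simp: p1_def)
    have p: "0 \<le> c / real n" "c / real n < 1" "c / real n = p1 + \<epsilon> / real n"
    proof -
      show "0 \<le> c / real n" "c / real n < 1" using n c n1 by simp_all
      show "c / real n = p1 + \<epsilon> / real n" by (simp add: p1_def c_eq add_divide_distrib)
    qed
    have split: "1 - (1 - p1) * (1 - p2) = c / real n" using p1 by (simp add: p2_def)
    have "1 - p2 \<le> 1 - \<epsilon> / real n"
    proof -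
      define e where "e = \<epsilon> / real n"
      have "0 \<le> e * p1" using \<epsilon> p1 by (simp add: e_def)
      then have "1 - (p1 + e) \<le> (1 - e) * (1 - p1)" by (simp add: algebra_simps)
      then have "1 - c / real n \<le> (1 - \<epsilon> / real n) * (1 - p1)" unfolding p(3) e_def .
      then show ?thesis using p1 by (simp add: p2_def divide_le_eq)
    qed
    then have p2: "\<epsilon> / real n \<le> p2" "0 \<le> p2" "p2 \<le> 1"
      using \<epsilon> p p1 n1 by (auto simp: p2_def intro: order_trans[of 0 "\<epsilon> / real n"])
    define x where "x = nat \<lfloor>\<delta> * sqrt (real n)\<rfloor>"
    have "1 \<le> x" using n by (simp add: x_def le_nat_iff)
    then obtain R where R: "2 ^ R \<le> x" "x < 2 ^ (R + 1)"
      using ex_power_ivl1[of 2 x] by auto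
    have "real x = of_int \<lfloor>\<delta> * sqrt (real n)\<rfloor>" using n by (simp add: x_def)
    then have x: "real x \<le> \<delta> * sqrt (real n)" "\<delta> * sqrt (real n) < real x + 1" by linarith+
    have R1: "2 ^ R \<le> \<delta> * sqrt (real n)"
      using x(1) R(1) by (metis of_nat_le_iff of_nat_numeral of_nat_power order_trans)
    have R2: "\<delta> * sqrt (real n) \<le> 2 ^ (R + 1)"
    proof -
      have "x + 1 \<le> 2 ^ (R + 1)" using R(2) by linarith
      then have "real (x + 1) \<le> real (2 ^ (R + 1))" by (rule of_nat_mono)
      then show ?thesis using x(2) by simp
    qed
    obtain h :: nat and m :: "nat \<Rightarrow> nat" where hm: "1 \<le> h" "\<And>s. s \<le> R \<Longrightarrow> 1 \<le> m s"
      "\<And>s. s \<le> R \<Longrightarrow> 8192 / 2 ^ s \<le> \<epsilon> / real n * (real h * real (m s))"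
      "real (2 ^ R * h + (\<Sum>s\<le>R. 4 * (R - s + 1) * 4 ^ s * m s)) \<le> \<theta> * real n"
      using connector_sizes[OF \<epsilon> \<delta> n1(1) R1] by blast
    have large: "8192 / 2 ^ s \<le> p2 * (real h * real (m s))" if "s \<le> R" for s
      using hm(3)[OF that] mult_right_mono[OF p2(1), of "real h * real (m s)"] by simp
    let ?bad = "\<lambda>X. \<not> (\<exists>xs. is_path n X xs \<and> \<theta> * real n \<le> real (length xs))"
    have step: "rs_prob ?V p2 (\<lambda>Y. \<not> \<delta> / 4 * sqrt (real n) \<le> real (ccl n (X \<union> Y)))
        \<le> of_bool (?bad X) + 1 / (\<delta> * sqrt (real n))" for X
    proof (cases "?bad X")
      case True
      have "rs_prob ?V p2 (\<lambda>Y. \<not> \<delta> / 4 * sqrt (real n) \<le> real (ccl n (X \<union> Y))) \<le> rs_expect ?V p2 (\<lambda>_. 1)"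
        using p2 by (intro rs_expect_mono) auto
      then show ?thesis using True \<delta>(1) by (simp add: rs_expect_const[OF finite_vertex_pairs] add_increasing2)
    next
      case False
      then obtain xs where xs: "is_path n X xs" "\<theta> * real n \<le> real (length xs)" by blast
      have len: "2 ^ R * h + (\<Sum>s\<le>R. 4 * (R - s + 1) * 4 ^ s * m s) \<le> length xs"
        using hm(4) xs(2) by linarith
      have "rs_prob ?V p2 (\<lambda>Y. \<not> \<delta> / 4 * sqrt (real n) \<le> real (ccl n (X \<union> Y)))
          \<le> rs_prob ?V p2 (\<lambda>Y. \<not> 2 ^ R \<le> 2 * ccl n (X \<union> Y))"
      proof (intro rs_expect_mono p2)
        fix Y
        have "\<delta> / 4 * sqrt (real n) \<le> real (ccl n (X \<union> Y))" if "2 ^ R \<le> 2 * ccl n (X \<union> Y)"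
        proof -
          have "real (2 ^ R) \<le> real (2 * ccl n (X \<union> Y))" using that by (rule of_nat_mono)
          then show ?thesis using R2 by simp
        qed
        then show "of_bool (\<not> \<delta> / 4 * sqrt (real n) \<le> real (ccl n (X \<union> Y)))
            \<le> (of_bool (\<not> 2 ^ R \<le> 2 * ccl n (X \<union> Y)) :: real)" by auto
      qed
      also have "\<dots> \<le> (1 / 2) ^ (R + 1)"
        by (rule rs_prob_ccl_path[OF p2(2,3) xs(1) len hm(1,2) large])
      also have "\<dots> = 1 / 2 ^ (R + 1)" by (simp add: power_one_over)
      also have "\<dots> \<le> 1 / (\<delta> * sqrt (real n))" using R2 n by (intro divide_left_mono) auto
      finally show ?thesis using False by simp
    qed
    have "?P n = rs_expect ?V p1 (\<lambda>X. rs_prob ?V p2 (\<lambda>Y. \<not> \<delta> / 4 * sqrt (real n) \<le> real (ccl n (X \<union> Y))))"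
      unfolding split[symmetric]
      by (rule rs_expect_sprinkle[OF finite_vertex_pairs,
            where g = "\<lambda>E. of_bool (\<not> \<delta> / 4 * sqrt (real n) \<le> real (ccl n E))", symmetric])
    also have "\<dots> \<le> rs_expect ?V p1 (\<lambda>X. of_bool (?bad X) + 1 / (\<delta> * sqrt (real n)))"
      using p1 by (intro rs_expect_mono step) auto
    also have "\<dots> = ?P1 n + 1 / (\<delta> * sqrt (real n))"
      unfolding rs_expect_add rs_expect_const[OF finite_vertex_pairs] p1_def ..
    finally show ?thesis .
  qed
  have sqrt_lim: "filterlim (\<lambda>n. \<delta> * sqrt (real n)) at_top sequentially"
    using \<delta>(1) by (intro filterlim_tendsto_pos_mult_at_top[OF tendsto_const]
      filterlim_compose[OF sqrt_at_top filterlim_real_sequentially])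
  have ev: "\<forall>\<^sub>F n in sequentially. c < real n \<and> 1 \<le> \<delta> * sqrt (real n)"
    using filterlim_real_sequentially[unfolded filterlim_at_top_dense] sqrt_lim[unfolded filterlim_at_top]
    by (intro eventually_conj) simp_all
  have "(\<lambda>n. ?P1 n + 1 / (\<delta> * sqrt (real n))) \<longlonglongrightarrow> 0 + 0"
    by (intro tendsto_add path_lim tendsto_divide_0[OF tendsto_const] filterlim_at_top_imp_at_infinity sqrt_lim)
  then have lim: "(\<lambda>n. ?P1 n + 1 / (\<delta> * sqrt (real n))) \<longlonglongrightarrow> 0" by simp
  have "?P \<longlonglongrightarrow> 0"
  proof (rule tendsto_sandwich[OF _ _ tendsto_const lim])
    show "\<forall>\<^sub>F n in sequentially. 0 \<le> ?P n"
      using ev by eventually_elim (use c in \<open>intro rs_expect_nonneg; auto\<close>)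
    show "\<forall>\<^sub>F n in sequentially. ?P n \<le> ?P1 n + 1 / (\<delta> * sqrt (real n))"
      using ev by eventually_elim (use bound in blast)
  qed
  then show ?thesis using \<delta>(1) by (intro exI[of _ "\<delta> / 4"]) simp
qed

theorem theorem3:
  fixes c :: real
  assumes "c > 1"
  shows "\<exists>\<delta>>0. (\<lambda>n. gnp_prob n (c / real n)
            (\<lambda>E. \<delta> * sqrt (real n) \<le> real (ccl n E) \<and>
                 real (ccl n E) \<le> 2 * sqrt (c * real n)))
          \<longlonglongrightarrow> 1"
proof -
  obtain \<delta> where \<delta>: "\<delta> > 0" and lower: "(\<lambda>n. rs_prob (vertex_pairs n) (c / real n)
      (\<lambda>E. \<not> \<delta> * sqrt (real n) \<le> real (ccl n E))) \<longlonglongrightarrow> 0"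
    using rs_prob_ccl_lower_tendsto[OF assms] by blast
  let ?L = "\<lambda>n E. \<delta> * sqrt (real n) \<le> real (ccl n E)"
  let ?U = "\<lambda>n E. real (ccl n E) \<le> 2 * sqrt (c * real n)"
  let ?pr = "\<lambda>n. rs_prob (vertex_pairs n) (c / real n)"
  have lim: "(\<lambda>n. ?pr n (\<lambda>E. \<not> ?L n E) + ?pr n (\<lambda>E. \<not> ?U n E)) \<longlonglongrightarrow> 0"
    using tendsto_add[OF lower rs_prob_ccl_upper_tendsto[OF assms]] by simp
  \<comment> \<open>Only for \<open>c \<le> n\<close> is \<open>c / n\<close> a probability, so
    nonnegativity and monotonicity of the expectations are used eventually.\<close>
  have ev: "\<forall>\<^sub>F n in sequentially. c \<le> real n"
    using filterlim_real_sequentially by (simp add: filterlim_at_top)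
  have "(\<lambda>n. ?pr n (\<lambda>E. \<not> (?L n E \<and> ?U n E))) \<longlonglongrightarrow> 0"
  proof (rule tendsto_sandwich[OF _ _ tendsto_const lim])
    show "\<forall>\<^sub>F n in sequentially. 0 \<le> ?pr n (\<lambda>E. \<not> (?L n E \<and> ?U n E))"
      using ev by eventually_elim (use assms in \<open>intro rs_expect_nonneg; auto\<close>)
    show "\<forall>\<^sub>F n in sequentially. ?pr n (\<lambda>E. \<not> (?L n E \<and> ?U n E))
        \<le> ?pr n (\<lambda>E. \<not> ?L n E) + ?pr n (\<lambda>E. \<not> ?U n E)"
      using ev unfolding rs_expect_add[symmetric]
      by eventually_elim (use assms in \<open>intro rs_expect_mono; auto\<close>)
  qed
  then have "(\<lambda>n. 1 - ?pr n (\<lambda>E. \<not> (?L n E \<and> ?U n E))) \<longlonglongrightarrow> 1 - 0"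
    by (intro tendsto_diff tendsto_const)
  then have "(\<lambda>n. gnp_prob n (c / real n) (\<lambda>E. ?L n E \<and> ?U n E)) \<longlonglongrightarrow> 1"
    unfolding rs_prob_not[OF finite_vertex_pairs] gnp_prob_eq by simp
  then show ?thesis using \<delta> by blast
qed

end
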